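(* Let $\beta>0$. The spin chain model $$\frac{d}{dt}\vec S_n=-\vec S_n\times\biggl(\frac{2\vec S_{n+1}}{1+\vec S_n\cdot\vec S_{n+1}}+\frac{2\vec S_{n-1}}{1+\vec S_n\cdot\vec S_{n-1}}\biggr),\qquad n\in\mathbb Z,$$ admits a unique Gibbs measure at inverse temperature $\beta$, i.e. there is exactly one probability measure on $(\mathbb S^2)^{\mathbb Z}$ satisfying the DLR condition. Moreover, for any integers $n\le m$ and any bounded continuous $f$, its expectation $\mathbb E_\beta$ satisfies $$\mathbb E_\beta\{f(\vec S_n,\dots,\vec S_m)\}=\frac1{4\pi}\int_{\mathbb S^2}\cdots\int_{\mathbb S^2}f(s_n,\dots,s_m)\prod_{k=n}^{m-1}p(s_k,s_{k+1})\,ds_n\cdots ds_m .$$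
   Context: $\mathbb S^2\subset\mathbb R^3$ is the unit sphere and $ds$ is area measure on $\mathbb S^2$ (total mass $4\pi$). Put $$p(s,\sigma)=\tfrac{1+2\beta}{4\pi}\exp\bigl\{2\beta\log\bigl(1-\tfrac14|s-\sigma|^2\bigr)\bigr\}=\tfrac{1+2\beta}{4\pi}\Bigl(\tfrac{1+s\cdot\sigma}{2}\Bigr)^{2\beta},\qquad s,\sigma\in\mathbb S^2 .$$ DLR condition (definition of a Gibbs measure at inverse temperature $\beta$ for the model): a probability measure on $\{\vec S_n\}_{n\in\mathbb Z}\in(\mathbb S^2)^{\mathbb Z}$ with expectation $\mathbb E_\beta$ satisfies the DLR condition if for all integers $a\le b$ and all bounded continuous $f$, $$\mathbb E_\beta\{f(\vec S_a,\dots,\vec S_b)\mid\vec S_{a-1},\vec S_{b+1}\}=\frac1{Z_{ab}}\int_{\mathbb S^2}\!\cdots\!\int_{\mathbb S^2}f(s_a,\dots,s_b)\,p(\vec S_{a-1},s_a)\,p(s_b,\vec S_{b+1})\prod_{k=a}^{b-1}p(s_k,s_{k+1})\,ds_a\cdots ds_b,$$ where $$Z_{ab}=\int_{\mathbb S^2}\!\cdots\!\int_{\mathbb S^2}p(\vec S_{a-1},s_a)\,p(s_b,\vec S_{b+1})\prod_{k=a}^{b-1}p(s_k,s_{k+1})\,ds_a\cdots ds_b .$$ *)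

theory Defs
  imports "HOL-Probability.Probability"
begin

abbreviation S2 :: "(real^3) set"
  where "S2 \<equiv> sphere 0 1"

abbreviation S2_borel :: "(real^3) measure"
  where "S2_borel \<equiv> restrict_space borel S2"

text \<open>
  Area measure on the sphere through polar coordinates: the area of \<open>A\<close> is three times the
  Lebesgue volume of the cone \<open>{r x | x \<in> A, 0 < r < 1}\<close>, which is the preimage of \<open>A\<close> in the
  punctured unit ball under the radial projection \<^const>\<open>sgn\<close>.
\<close>

definition S2_area :: "(real^3) measure"
  where "S2_area = scale_measure 3 (distr (restrict_space lborel (ball 0 1 - {0})) S2_borel sgn)"

lemma sets_S2_area: "sets S2_area = sets S2_borel"
  by (simp add: S2_area_def)

lemma measurable_sgn_S2:
  "sgn \<in> restrict_space lborel (ball 0 1 - {0}) \<rightarrow>\<^sub>M S2_borel"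
proof (rule measurable_restrict_space2)
  show "sgn \<in> space (restrict_space lborel (ball 0 1 - {0})) \<rightarrow> S2"
    by (auto simp: space_restrict_space norm_sgn)
  have "(sgn :: real^3 \<Rightarrow> real^3) \<in> borel_measurable borel"
    unfolding sgn_div_norm by measurable
  then show "(sgn :: real^3 \<Rightarrow> real^3) \<in> borel_measurable (restrict_space lborel (ball 0 1 - {0}))"
    by (intro measurable_restrict_space1) simp
qed

lemma emeasure_S2_area: "emeasure S2_area (space S2_area) = ennreal (4 * pi)"
proof -
  have "emeasure lborel (ball (0 :: real^3) 1 - {0}) = emeasure lborel (ball (0 :: real^3) 1)"
    by (subst emeasure_Diff) auto
  also have "\<dots> = ennreal (4 / 3 * pi)"
    by (simp add: emeasure_ball unit_ball_vol_3)
  finally have "emeasure lborel (ball (0 :: real^3) 1 - {0}) = ennreal (4 / 3 * pi)" .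
  moreover have "space S2_area = S2"
    by (simp add: S2_area_def space_scale_measure space_restrict_space)
  moreover have "sgn -` S2 \<inter> (ball (0 :: real^3) 1 - {0}) = ball 0 1 - {0}"
    by (auto simp: norm_sgn)
  moreover have "S2 \<in> sets S2_borel"
    by (simp add: sets_restrict_space_iff)
  ultimately show ?thesis
    by (simp add: S2_area_def emeasure_distr[OF measurable_sgn_S2] space_restrict_space
        emeasure_restrict_space ennreal_mult'[symmetric] flip: ennreal_numeral)
qed

text \<open>
  At antipodal points the base of the power vanishes and \<open>0 powr (2 * \<beta>) = 0\<close>, which agrees with
  the reading \<open>exp (2 * \<beta> * log 0) = 0\<close>.
\<close>

definition spin_kernel :: "real \<Rightarrow> real^3 \<Rightarrow> real^3 \<Rightarrow> real"
  where "spin_kernel \<beta> s \<sigma> = (1 + 2 * \<beta>) / (4 * pi) * ((1 + s \<bullet> \<sigma>) / 2) powr (2 * \<beta>)"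

lemma spin_kernel_exp:
  assumes "s \<in> S2" "\<sigma> \<in> S2" "\<sigma> \<noteq> - s"
  shows "spin_kernel \<beta> s \<sigma> =
    (1 + 2 * \<beta>) / (4 * pi) * exp (2 * \<beta> * ln (1 - 1 / 4 * (norm (s - \<sigma>))\<^sup>2))"
proof -
  have *: "1 - 1 / 4 * (norm (s - \<sigma>))\<^sup>2 = (1 + s \<bullet> \<sigma>) / 2"
    using assms by (simp add: power2_norm_eq_inner algebra_simps inner_commute norm_eq_1)
  have "(norm (s + \<sigma>))\<^sup>2 = 2 * (1 + s \<bullet> \<sigma>)"
    using assms by (simp add: power2_norm_eq_inner algebra_simps inner_commute norm_eq_1)
  moreover have "(norm (s + \<sigma>))\<^sup>2 \<noteq> 0"
    using assms by (simp add: add_eq_0_iff)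
  ultimately have "(1 + s \<bullet> \<sigma>) / 2 \<noteq> 0"
    by auto
  then show ?thesis
    unfolding * by (simp add: spin_kernel_def powr_def)
qed

text \<open>
  A tuple \<open>(s\<^sub>a, \<dots>, s\<^sub>b)\<close> is an element of \<open>{a..b} \<rightarrow>\<^sub>E S2\<close>.
\<close>

definition chain_weight :: "real \<Rightarrow> int \<Rightarrow> int \<Rightarrow> (int \<Rightarrow> real^3) \<Rightarrow> real"
  where "chain_weight \<beta> a b s = (\<Prod>k\<in>{a..b - 1}. spin_kernel \<beta> (s k) (s (k + 1)))"

definition boundary_weight ::
    "real \<Rightarrow> int \<Rightarrow> int \<Rightarrow> real^3 \<Rightarrow> real^3 \<Rightarrow> (int \<Rightarrow> real^3) \<Rightarrow> real"
  where "boundary_weight \<beta> a b u v s =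
    spin_kernel \<beta> u (s a) * spin_kernel \<beta> (s b) v * chain_weight \<beta> a b s"

definition partition_fun :: "real \<Rightarrow> int \<Rightarrow> int \<Rightarrow> real^3 \<Rightarrow> real^3 \<Rightarrow> real"
  where "partition_fun \<beta> a b u v =
    (LINT s|Pi\<^sub>M {a..b} (\<lambda>_. S2_area). boundary_weight \<beta> a b u v s)"

definition bounded_continuous :: "int \<Rightarrow> int \<Rightarrow> ((int \<Rightarrow> real^3) \<Rightarrow> real) \<Rightarrow> bool"
  where "bounded_continuous a b f \<longleftrightarrow>
    continuous_map (product_topology (\<lambda>_. top_of_set S2) {a..b}) euclideanreal f \<and>
    bounded (f ` ({a..b} \<rightarrow>\<^sub>E S2))"

definition config_space :: "(int \<Rightarrow> real^3) measure"
  where "config_space = Pi\<^sub>M UNIV (\<lambda>_. S2_borel)"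

text \<open>The \<open>\<sigma>\<close>-algebra generated by the two spins adjacent to the block \<open>{a..b}\<close>.\<close>

definition boundary_algebra :: "int \<Rightarrow> int \<Rightarrow> (int \<Rightarrow> real^3) measure"
  where "boundary_algebra a b =
    vimage_algebra (space config_space) (\<lambda>S. (S (a - 1), S (b + 1))) (S2_borel \<Otimes>\<^sub>M S2_borel)"

definition DLR :: "real \<Rightarrow> (int \<Rightarrow> real^3) measure \<Rightarrow> bool"
  where "DLR \<beta> M \<longleftrightarrow>
    (\<forall>a b f. a \<le> b \<longrightarrow> bounded_continuous a b f \<longrightarrow>
      (AE S in M. real_cond_exp M (boundary_algebra a b) (\<lambda>S. f (restrict S {a..b})) S =
        1 / partition_fun \<beta> a b (S (a - 1)) (S (b + 1)) *
          (LINT s|Pi\<^sub>M {a..b} (\<lambda>_. S2_area).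
            f s * boundary_weight \<beta> a b (S (a - 1)) (S (b + 1)) s)))"

text \<open>
  Gibbs measures at inverse temperature \<open>\<beta>\<close> for the spin chain
  \<open>dS\<^sub>n/dt = - S\<^sub>n \<times> (2 S\<^sub>n\<^sub>+\<^sub>1 / (1 + S\<^sub>n \<bullet> S\<^sub>n\<^sub>+\<^sub>1) + 2 S\<^sub>n\<^sub>-\<^sub>1 / (1 + S\<^sub>n \<bullet> S\<^sub>n\<^sub>-\<^sub>1))\<close>; the model enters only
  through the nearest-neighbour weight \<^const>\<open>spin_kernel\<close>.
\<close>

definition gibbs_measure :: "real \<Rightarrow> (int \<Rightarrow> real^3) measure \<Rightarrow> bool"
  where "gibbs_measure \<beta> M \<longleftrightarrow> prob_space M \<and> sets M = sets config_space \<and> DLR \<beta> M"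

end

theory Submission
  imports Defs
begin

text \<open>
  By Archimedes' hat-box theorem \<^term>\<open>spin_kernel \<beta>\<close> is a symmetric Markov kernel with respect to
  area, so the unnormalised DLR weights of a block integrate out to iterates of the transfer operator
  acting on the two boundary kernels. The square of that operator satisfies a Doeblin minorisation,
  hence its iterates converge uniformly to the uniform density \<open>1 / (4 * pi)\<close>. Applying the DLR
  condition to ever larger blocks therefore forces the expectation of every local observable, which
  gives the formula and uniqueness. Conversely the stationary Markov chain with this kernel exists by
  Kolmogorov's extension theorem, and it satisfies the DLR condition by Fubini's theorem.
\<close>

subsection \<open>The hat-box theorem\<close>

text \<open>A single step cannot be minorised, because \<open>spin_kernel\<close> vanishes at
  antipodal pairs; an intermediate spin can stay away from both antipodes, which is why the argument
  moves two sites at a time. The convergence has to be uniform in the starting point, since the DLR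
  boundary spins change with the block and nothing is known about their law. Given this, numerator
  and partition function converge separately, and the quotient tends to a constant that has
  forgotten the boundary.

  Existence and uniqueness share one family of weights, \<open>end_weight\<close>: a chain with an
  arbitrary density attached to either end. It contains the DLR weights as well as the stationary
  marginals, and it is closed under integrating out an end spin.

  The sphere is a subset of \<open>real^3\<close> and not a type, whereas the extension theorem and
  the Borel sets of a function space refer to whole types. Measures are therefore moved to
  \<open>int \<Rightarrow> real^3\<close> and brought back by the coordinatewise retraction
  \<open>S2_retract\<close>.\<close>

lemma distr_norm_square_plane:
  "distr lborel borel (\<lambda>x :: real \<times> real. (norm x)\<^sup>2) =
    density lborel (\<lambda>w. ennreal pi * indicator {0<..} w)" (is "?L = ?R")
proof (rule measure_eqI_generator_eq[where E = "range lessThan" and \<Omega> = UNIV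
      and A = "\<lambda>n. {..<real n}"])
  show "Int_stable (range (lessThan :: real \<Rightarrow> _))"
    by (auto simp: Int_stable_def image_iff intro: exI[of _ "min _ _"])
  \<comment> \<open>The disc of squared radius \<open>a\<close> has area \<open>pi * a\<close>,
    linear in \<open>a\<close>; this is why the squared norm, and not the norm, has a constant
    density.\<close>
  have eq: "emeasure ?L {..<a} = ennreal (pi * max 0 a)" for a :: real
  proof -
    have "emeasure ?L {..<a} = emeasure lborel {x :: real \<times> real. (norm x)\<^sup>2 < a}"
      by (simp add: emeasure_distr vimage_def)
    also have "{x :: real \<times> real. (norm x)\<^sup>2 < a} = (if a > 0 then ball 0 (sqrt a) else {})"
      by (auto simp: real_less_rsqrt not_less intro: order.trans dest: real_less_lsqrt)
         (metis abs_norm_cancel norm_ge_zero not_le order_less_le_trans real_sqrt_abs real_sqrt_less_iff)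
    also have "emeasure lborel \<dots> = ennreal (pi * max 0 a)"
      by (simp add: emeasure_ball unit_ball_vol_2)
    finally show ?thesis .
  qed
  have eq': "emeasure ?R {..<a} = ennreal (pi * max 0 a)" for a :: real
  proof -
    have "emeasure ?R {..<a} = (\<integral>\<^sup>+w. ennreal pi * indicator {0<..<a} w \<partial>lborel)"
      by (auto simp: emeasure_density indicator_def intro!: nn_integral_cong)
    also have "\<dots> = ennreal pi * ennreal (max 0 a)"
      by (subst nn_integral_cmult_indicator) (auto simp: max_def)
    finally show ?thesis
      by (simp add: ennreal_mult)
  qed
  show "emeasure ?L X = emeasure ?R X" if "X \<in> range lessThan" for X
    using that by (auto simp: eq eq')
  show "emeasure ?L {..<real n} \<noteq> \<infinity>" for n
    by (simp add: eq)
  show "(\<Union>n. {..<real n}) = UNIV"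
    by (auto intro: reals_Archimedean2)
qed (auto simp: borel_Iio intro!: sets_measure_of)

text \<open>The substitutions \<open>w = |y|\<^sup>2\<close>, \<open>q = z\<^sup>2 + w\<close> and \<open>c = z / sqrt q\<close> decouple the radius from the
  direction; the case \<open>h = 1\<close> then evaluates the radial factor.\<close>

lemma nn_integral_ball_direction_aux:
  fixes h :: "real \<Rightarrow> ennreal"
  assumes [measurable]: "h \<in> borel_measurable borel"
  shows "(\<integral>\<^sup>+x. indicator (ball 0 1) x * h (fst x / norm x) \<partial>(lborel :: (real \<times> real \<times> real) measure)) =
    (ennreal pi * (\<integral>\<^sup>+q. ennreal (sqrt q) * indicator {0<..<1} q \<partial>lborel)) *
      (\<integral>\<^sup>+c. h c * indicator {-1..1} c \<partial>lborel)"
proof -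
  \<comment> \<open>\<open>g q z\<close> is the integrand after \<open>w\<close> has been replaced
    by \<open>q - z\<^sup>2\<close>; the guard \<open>z\<^sup>2 < q\<close> is what remains of
    \<open>w > 0\<close>.\<close>
  define g where "g q z = indicator {0<..<1} q * (if z\<^sup>2 < q then h (z / sqrt q) else 0 :: ennreal)" for q z :: real
  have [measurable]: "(\<lambda>(z, q). g q z) \<in> borel_measurable (lborel \<Otimes>\<^sub>M lborel)"
    "(\<lambda>(q, z). g q z) \<in> borel_measurable (lborel \<Otimes>\<^sub>M lborel)"
    unfolding g_def by measurable
  have [measurable]: "g q \<in> borel_measurable borel" for q
    unfolding g_def by measurable
  have [measurable]: "(\<lambda>q. g q z) \<in> borel_measurable borel" for z
    unfolding g_def by measurable
  have [measurable]: "(fst :: real \<times> real \<times> real \<Rightarrow> real) \<in> borel_measurable borel"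
    "ball (0 :: real \<times> real \<times> real) 1 \<in> sets borel"
    by (auto intro!: borel_measurable_continuous_onI continuous_intros)
  have m: "(\<lambda>x :: real \<times> real \<times> real. indicator (ball 0 1) x * h (fst x / norm x)) \<in> borel_measurable borel"
    by measurable
  have "(\<integral>\<^sup>+x. indicator (ball 0 1) x * h (fst x / norm x) \<partial>(lborel :: (real \<times> real \<times> real) measure)) =
    (\<integral>\<^sup>+z. \<integral>\<^sup>+y. indicator (ball 0 1) (z, y) * h (z / norm (z, y)) \<partial>(lborel :: (real \<times> real) measure) \<partial>lborel)"
    using lborel.nn_integral_fst[of "\<lambda>x. indicator (ball 0 1) x * h (fst x / norm (x :: real \<times> real \<times> real))"
        "lborel :: real measure", symmetric] m
    unfolding lborel_prod by simp
  also have "\<dots> = (\<integral>\<^sup>+z. \<integral>\<^sup>+y. indicator {..<1} (z\<^sup>2 + (norm y)\<^sup>2) * h (z / sqrt (z\<^sup>2 + (norm y)\<^sup>2)) \<partial>(lborel :: (real \<times> real) measure) \<partial>lborel)"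
    by (intro nn_integral_cong arg_cong2[where f = "(*)"])
       (auto simp: norm_Pair indicator_def real_sqrt_less_iff)
  also have "\<dots> = (\<integral>\<^sup>+z. \<integral>\<^sup>+w. indicator {..<1} (z\<^sup>2 + w) * h (z / sqrt (z\<^sup>2 + w)) \<partial>(distr lborel borel (\<lambda>x :: real \<times> real. (norm x)\<^sup>2)) \<partial>lborel)"
    by (subst nn_integral_distr) auto
  also have "\<dots> = (\<integral>\<^sup>+z. \<integral>\<^sup>+w. ennreal pi * g (z\<^sup>2 + w) z \<partial>lborel \<partial>lborel)"
    unfolding distr_norm_square_plane g_def
    by (subst nn_integral_density)
       (auto intro!: nn_integral_cong simp: indicator_def mult_ac add_nonneg_pos)
  also have "\<dots> = (\<integral>\<^sup>+z. ennreal pi * (\<integral>\<^sup>+q. g q z \<partial>lborel) \<partial>lborel)"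
  proof (rule nn_integral_cong)
    fix z :: real
    have "(\<integral>\<^sup>+w. ennreal pi * g (z\<^sup>2 + w) z \<partial>lborel) = ennreal pi * (\<integral>\<^sup>+w. g (z\<^sup>2 + w) z \<partial>lborel)"
      by (rule nn_integral_cmult) simp
    also have "(\<integral>\<^sup>+w. g (z\<^sup>2 + w) z \<partial>lborel) = (\<integral>\<^sup>+q. g q z \<partial>lborel)"
      using nn_integral_real_affine[of "\<lambda>q. g q z" 1 "z\<^sup>2"] by simp
    finally show "(\<integral>\<^sup>+w. ennreal pi * g (z\<^sup>2 + w) z \<partial>lborel) = ennreal pi * (\<integral>\<^sup>+q. g q z \<partial>lborel)" .
  qed
  also have "\<dots> = ennreal pi * (\<integral>\<^sup>+z. \<integral>\<^sup>+q. g q z \<partial>lborel \<partial>lborel)"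
    by (rule nn_integral_cmult) measurable
  \<comment> \<open>The order is swapped so that \<open>q\<close> is fixed while \<open>z\<close> is
    integrated: then \<open>z = sqrt q * c\<close> is a linear substitution with Jacobian
    \<open>sqrt q\<close>, and the range of \<open>c\<close> does not depend on
    \<open>q\<close>.\<close>
  also have "(\<integral>\<^sup>+z. \<integral>\<^sup>+q. g q z \<partial>lborel \<partial>lborel) = (\<integral>\<^sup>+q. \<integral>\<^sup>+z. g q z \<partial>lborel \<partial>lborel)"
    by (rule lborel_pair.Fubini') measurable
  also have "\<dots> = (\<integral>\<^sup>+q. ennreal (sqrt q) * indicator {0<..<1} q * (\<integral>\<^sup>+c. h c * indicator {-1<..<1} c \<partial>lborel) \<partial>lborel)"
  proof (rule nn_integral_cong)
    fix q :: real
    show "(\<integral>\<^sup>+z. g q z \<partial>lborel) =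
      ennreal (sqrt q) * indicator {0<..<1} q * (\<integral>\<^sup>+c. h c * indicator {-1<..<1} c \<partial>lborel)"
    proof (cases "0 < q \<and> q < 1")
      case True
      have "g q (0 + sqrt q * c) = h c * indicator {-1<..<1} c" for c
      proof -
        have "(sqrt q * c)\<^sup>2 < q \<longleftrightarrow> \<bar>c\<bar> < 1"
          using True by (simp add: power_mult_distrib abs_square_less_1)
        then show ?thesis
          using True by (auto simp: g_def indicator_def abs_less_iff)
      qed
      then show ?thesis
        using True nn_integral_real_affine[of "g q" "sqrt q" 0] by simp
    qed (auto simp: g_def)
  qed
  also have "\<dots> = (\<integral>\<^sup>+q. ennreal (sqrt q) * indicator {0<..<1} q \<partial>lborel) * (\<integral>\<^sup>+c. h c * indicator {-1<..<1} c \<partial>lborel)"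
    by (rule nn_integral_multc) measurable
  also have "(\<integral>\<^sup>+c. h c * indicator {-1<..<1} c \<partial>lborel) = (\<integral>\<^sup>+c. h c * indicator {-1..1} c \<partial>lborel)"
  proof (rule nn_integral_cong_AE)
    show "AE c in lborel. h c * indicator {-1<..<1} c = h c * indicator {-1..1} c"
      using AE_lborel_singleton[of 1] AE_lborel_singleton[of "-1"]
      by eventually_elim (auto simp: indicator_def)
  qed
  finally show ?thesis
    by (simp only: mult.assoc)
qed

lemma nn_integral_ball_direction:
  fixes h :: "real \<Rightarrow> ennreal"
  assumes h: "h \<in> borel_measurable borel"
  shows "(\<integral>\<^sup>+x. indicator (ball 0 1) x * h (fst x / norm x) \<partial>(lborel :: (real \<times> real \<times> real) measure)) =
    ennreal (2 * pi / 3) * (\<integral>\<^sup>+c. h c * indicator {-1..1} c \<partial>lborel)"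
proof -
  define K where "K = ennreal pi * (\<integral>\<^sup>+q. ennreal (sqrt q) * indicator {0<..<1} q \<partial>lborel)"
  have "ennreal (4 / 3 * pi) = K * 2"
    using nn_integral_ball_direction_aux[of "\<lambda>_. 1", folded K_def]
    by (simp add: emeasure_ball unit_ball_vol_3)
  then have "K = ennreal (2 * pi / 3)"
    by (cases K) (auto simp: ennreal_mult_top ennreal_top_mult simp flip: ennreal_numeral ennreal_mult)
  then show ?thesis
    using nn_integral_ball_direction_aux[OF h, folded K_def] by simp
qed


section \<open>Lebesgue measure on \<open>real^3\<close>: coordinates and rotations\<close>

lemma borel_measurable_vector_3[measurable]:
  "(\<lambda>v :: real \<times> real \<times> real. vector [fst v, fst (snd v), snd (snd v)] :: real ^ 3) \<in> borel_measurable borel"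
proof -
  have "(\<lambda>v. (vector [fst v, fst (snd v), snd (snd v)] :: real^3) \<bullet> b) \<in> borel_measurable borel"
    if "b \<in> Basis" for b
  proof -
    from that obtain i where b: "b = axis i 1"
      by (auto simp: Basis_vec_def Basis_real_def)
    show ?thesis
      unfolding b inner_axis using exhaust_3[of i]
      by (elim disjE) (auto intro!: borel_measurable_continuous_onI continuous_intros)
  qed
  then show ?thesis
    by (subst borel_measurable_euclidean_space) blast
qed

lemma box_Pair:
  fixes a c :: "'a::euclidean_space" and b d :: "'b::euclidean_space"
  shows "box (a, b) (c, d) = box a c \<times> box b d"
  by (auto simp: box_def Basis_prod_def ball_Un)

text \<open>Bridges the vector type \<open>real^3\<close>, on which the area measure lives, and
  nested pairs, on which Fubini splits off the first coordinate. Both sides agree on boxes.\<close>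

lemma lborel_real3: "lborel = distr (lborel :: (real \<times> real \<times> real) measure) borel
    (\<lambda>v. vector [fst v, fst (snd v), snd (snd v)] :: real ^ 3)"
proof (rule lborel_eqI)
  fix l u :: "real^3"
  assume lu: "\<And>b. b \<in> Basis \<Longrightarrow> l \<bullet> b \<le> u \<bullet> b"
  have prod3: "(\<Prod>i\<in>UNIV. f i) = f 1 * (f 2 * f (3 :: 3))" for f :: "3 \<Rightarrow> real"
    unfolding UNIV_3 by simp
  have le: "l $ i \<le> u $ i" for i
    using lu[of "axis i 1"] by (auto simp: inner_axis Basis_vec_def)
  have "emeasure (distr (lborel :: (real \<times> real \<times> real) measure) borel (\<lambda>v. vector [fst v, fst (snd v), snd (snd v)] :: real ^ 3)) (box l u) =
    emeasure lborel (box (l $ 1, l $ 2, l $ 3) (u $ 1, u $ 2, u $ 3))"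
    by (subst emeasure_distr)
       (auto intro!: arg_cong2[where f = emeasure] simp: mem_box_cart forall_3 box_Pair)
  also have "\<dots> = emeasure (lborel \<Otimes>\<^sub>M lborel \<Otimes>\<^sub>M lborel) ({l $ 1<..<u $ 1} \<times> {l $ 2<..<u $ 2} \<times> {l $ 3<..<u $ 3})"
    by (auto simp: lborel_prod box_Pair box_real intro!: arg_cong2[where f = emeasure])
  also have "\<dots> = ennreal (\<Prod>i\<in>UNIV. u $ i - l $ i)"
    using le by (simp add: lborel.emeasure_pair_measure_Times prod3 mult.assoc lborel_pair.emeasure_pair_measure_Times
        lborel_prod[symmetric] flip: ennreal_mult)
  also have "(\<Prod>i\<in>UNIV. u $ i - l $ i) = (\<Prod>b\<in>Basis. (u - l) \<bullet> b)"
    using content_cbox_cart[of l u] content_cbox'[of l u] le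
    by (simp add: interval_ne_empty_cart inner_diff_left)
  finally show "emeasure (distr (lborel :: (real \<times> real \<times> real) measure) borel (\<lambda>v. vector [fst v, fst (snd v), snd (snd v)] :: real ^ 3)) (box l u) =
    ennreal (\<Prod>b\<in>Basis. (u - l) \<bullet> b)" .
qed simp

text \<open>The preimage of a box is its image under the inverse isometry, and isometries preserve
  the Lebesgue measure of images; agreement on boxes suffices.\<close>

lemma distr_lborel_orthogonal:
  fixes f :: "real^'n::{finite,wellorder} \<Rightarrow> real^'n::_"
  assumes f: "orthogonal_transformation f"
  shows "distr lborel borel f = lborel"
proof (rule lborel_eqI[symmetric])
  have lin: "linear f" and inv: "orthogonal_transformation (inv f)" and bij: "bij f"
    using f by (auto intro: orthogonal_transformation_linear orthogonal_transformation_inv orthogonal_transformation_bij)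
  have [measurable]: "f \<in> borel_measurable borel"
    using lin by (intro borel_measurable_continuous_onI linear_continuous_on linear_conv_bounded_linear[THEN iffD1])
  fix l u :: "real^'n::{finite,wellorder}"
  assume "\<And>b. b \<in> Basis \<Longrightarrow> l \<bullet> b \<le> u \<bullet> b"
  then have box: "emeasure lborel (box l u) = ennreal (\<Prod>b\<in>Basis. (u - l) \<bullet> b)"
    by (rule emeasure_lborel_box)
  have "f -` box l u = inv f ` box l u"
    using bij by (simp add: bij_vimage_eq_inv_image)
  then have "emeasure (distr lborel borel f) (box l u) = emeasure lebesgue (inv f ` box l u)"
    using measurable_sets[of f borel borel "box l u"] by (simp add: emeasure_distr)
  also have "\<dots> = emeasure lebesgue (box l u)"
    using measurable_orthogonal_image[OF inv, of "box l u"] measure_orthogonal_image[OF inv, of "box l u"]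
    by (simp add: emeasure_eq_measure2)
  finally show "emeasure (distr lborel borel f) (box l u) = ennreal (\<Prod>b\<in>Basis. (u - l) \<bullet> b)"
    using box by simp
qed simp

text \<open>The puncture in \<open>S2_area\<close> keeps \<open>sgn\<close> on the sphere; as the
  origin is a null set, the integral may run over the full ball.\<close>

lemma nn_integral_S2_area:
  assumes [measurable]: "g \<in> borel_measurable borel"
  shows "(\<integral>\<^sup>+\<sigma>. g \<sigma> \<partial>S2_area) = 3 * (\<integral>\<^sup>+x. indicator (ball 0 1) x * g (sgn x) \<partial>lborel)"
proof -
  have "(\<integral>\<^sup>+\<sigma>. g \<sigma> \<partial>S2_area) = 3 * (\<integral>\<^sup>+\<sigma>. g \<sigma> \<partial>distr (restrict_space lborel (ball 0 1 - {0})) S2_borel sgn)"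
    unfolding S2_area_def by (rule nn_integral_scale_measure) (simp add: measurable_restrict_space1)
  also have "(\<integral>\<^sup>+\<sigma>. g \<sigma> \<partial>distr (restrict_space lborel (ball 0 1 - {0})) S2_borel sgn) =
      (\<integral>\<^sup>+x. g (sgn x) \<partial>restrict_space lborel (ball 0 1 - {0}))"
    by (rule nn_integral_distr[OF measurable_sgn_S2]) (simp add: measurable_restrict_space1)
  also have "\<dots> = (\<integral>\<^sup>+x. g (sgn x) * indicator (ball 0 1 - {0}) x \<partial>lborel)"
    by (rule nn_integral_restrict_space) simp
  also have "\<dots> = (\<integral>\<^sup>+x. indicator (ball 0 1) x * g (sgn x) \<partial>lborel)"
  proof (rule nn_integral_cong_AE)
    show "AE x in lborel. g (sgn x) * indicator (ball 0 1 - {0}) x = indicator (ball 0 1) x * g (sgn x)"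
      using AE_lborel_singleton[of 0] by eventually_elim (auto simp: indicator_def)
  qed
  finally show ?thesis .
qed

text \<open>This is the hat-box theorem: projecting the area measure to the axis of \<open>u\<close>
  gives \<open>2 * pi\<close> times Lebesgue measure on the interval from -1 to 1. A rotation
  carries the first axis to \<open>u\<close>; the constant is the factor 3 of \<open>S2_area\<close>
  times the \<open>2 * pi / 3\<close> of \<open>nn_integral_ball_direction\<close>.\<close>

lemma nn_integral_S2_inner:
  fixes h :: "real \<Rightarrow> ennreal"
  assumes [measurable]: "h \<in> borel_measurable borel" and u: "u \<in> S2"
  shows "(\<integral>\<^sup>+\<sigma>. h (u \<bullet> \<sigma>) \<partial>S2_area) = ennreal (2 * pi) * (\<integral>\<^sup>+c. h c * indicator {-1..1} c \<partial>lborel)"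
proof -
  have [measurable]: "ball (0 :: real^3) 1 \<in> sets borel"
    by simp
  obtain f :: "real^3 \<Rightarrow> real^3" where f: "orthogonal_transformation f" "f (axis 1 1) = u"
    using orthogonal_transformation_exists_1[of "axis 1 1" u] u by auto
  have f_inner: "f x \<bullet> f y = x \<bullet> y" for x y
    using f by (simp add: orthogonal_transformation_def)
  have f_norm: "norm (f x) = norm x" for x
    using f by (simp add: orthogonal_transformation_norm)
  have [measurable]: "f \<in> borel_measurable borel"
    using f(1)[THEN orthogonal_transformation_linear]
    by (intro borel_measurable_continuous_onI linear_continuous_on linear_conv_bounded_linear[THEN iffD1])
  have "(\<integral>\<^sup>+\<sigma>. h (u \<bullet> \<sigma>) \<partial>S2_area) = 3 * (\<integral>\<^sup>+x. indicator (ball 0 1) x * h (u \<bullet> sgn x) \<partial>lborel)"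
    by (rule nn_integral_S2_area) simp
  also have "(\<integral>\<^sup>+x. indicator (ball 0 1) x * h (u \<bullet> sgn x) \<partial>lborel) =
      (\<integral>\<^sup>+x. indicator (ball 0 1) x * h (u \<bullet> sgn x) \<partial>distr lborel borel f)"
    by (simp add: distr_lborel_orthogonal[OF f(1)])
  also have "\<dots> = (\<integral>\<^sup>+x. indicator (ball 0 1) (f x) * h (u \<bullet> sgn (f x)) \<partial>lborel)"
    by (rule nn_integral_distr) measurable
  also have "\<dots> = (\<integral>\<^sup>+x. indicator (ball 0 1) x * h (x $ 1 / norm x) \<partial>(lborel :: (real^3) measure))"
    by (rule nn_integral_cong)
       (simp add: f(2)[symmetric] sgn_div_norm f_inner f_norm inner_axis' indicator_def divide_inverse mult.commute)
  also have "\<dots> = (\<integral>\<^sup>+x. indicator (ball 0 1) x * h (fst x / norm x) \<partial>(lborel :: (real \<times> real \<times> real) measure))"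
  proof -
    have "norm (vector [x, y, z] :: real^3) = norm (x, y, z)" for x y z :: real
      by (simp add: norm_vec_def L2_set_def sum_3 norm_Pair add.assoc)
    then show ?thesis
      by (subst lborel_real3, subst nn_integral_distr) (auto intro!: nn_integral_cong simp: indicator_def)
  qed
  also have "\<dots> = ennreal (2 * pi / 3) * (\<integral>\<^sup>+c. h c * indicator {-1..1} c \<partial>lborel)"
    by (rule nn_integral_ball_direction) simp
  finally show ?thesis
    by (simp add: mult.assoc[symmetric] flip: ennreal_mult ennreal_numeral)
qed

text \<open>After projection, \<open>c = 2 * t - 1\<close> leaves the integral of
  \<open>t powr a\<close> over the unit interval. For \<open>a = 2 * \<beta>\<close> the value is
  the reciprocal of the normalising constant in \<open>spin_kernel\<close>.\<close>

lemma nn_integral_S2_kernel_power: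
  assumes u: "u \<in> S2" and a: "a \<ge> 0"
  shows "(\<integral>\<^sup>+\<sigma>. ennreal (((1 + u \<bullet> \<sigma>) / 2) powr a) \<partial>S2_area) = ennreal (4 * pi / (1 + a))"
proof -
  have "((\<lambda>t :: real. t powr a) has_integral (1 powr (a + 1) / (a + 1))) {0..1}"
    using a by (intro has_integral_powr_from_0) auto
  then have *: "(\<integral>\<^sup>+t. ennreal (indicator {0..1} t * t powr a) \<partial>lborel) = ennreal (1 / (a + 1))"
    by (subst nn_integral_has_integral_lebesgue) (auto)
  have "(\<integral>\<^sup>+\<sigma>. ennreal (((1 + u \<bullet> \<sigma>) / 2) powr a) \<partial>S2_area) =
      ennreal (2 * pi) * (\<integral>\<^sup>+c. ennreal (((1 + c) / 2) powr a) * indicator {-1..1} c \<partial>lborel)"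
    by (rule nn_integral_S2_inner[OF _ u]) simp
  also have "(\<integral>\<^sup>+c. ennreal (((1 + c) / 2) powr a) * indicator {-1..1} c \<partial>lborel) =
      2 * (\<integral>\<^sup>+t. ennreal (indicator {0..1} t * t powr a) \<partial>lborel)"
    by (subst nn_integral_real_affine[where c = 2 and t = "-1"])
       (auto simp: indicator_def intro!: nn_integral_cong arg_cong2[where f = "(*)"])
  finally show ?thesis
    using * a by (simp add: ac_simps flip: ennreal_mult ennreal_numeral)
qed

subsection \<open>The transfer operator\<close>

text \<open>Keeps \<open>x \<in> S2\<close> as an atom instead of a norm equation, so that facts
  stated for points of \<open>S2\<close> still match.\<close>

declare mem_sphere_0 [simp del] mem_sphere [simp del]

lemma space_S2_area[simp]: "space S2_area = S2"
  by (simp add: S2_area_def space_scale_measure space_restrict_space)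

lemma sets_S2_area_cong[measurable_cong]: "sets S2_area = sets S2_borel"
  by (rule sets_S2_area)

interpretation S2_area: finite_measure S2_area
  by standard (use emeasure_S2_area in simp)

lemma measure_S2_area: "measure S2_area S2 = 4 * pi"
  using emeasure_S2_area by (simp add: measure_def)

lemma measurable_ident_S2[measurable]:
  "(\<lambda>x. x) \<in> S2_borel \<rightarrow>\<^sub>M borel" "(\<lambda>x. x) \<in> S2_area \<rightarrow>\<^sub>M borel"
  by (simp_all add: measurable_restrict_space1 measurable_cong_sets[OF sets_S2_area refl])

lemma abs_inner_S2_le:
  assumes "s \<in> S2" "t \<in> S2"
  shows "-1 \<le> s \<bullet> t" "s \<bullet> t \<le> 1"
  using Cauchy_Schwarz_ineq2[of s t] assms by (auto simp: mem_sphere_0)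

lemma spin_kernel_commute: "spin_kernel \<beta> s t = spin_kernel \<beta> t s"
  by (simp add: spin_kernel_def inner_commute)

lemma borel_measurable_spin_kernel[measurable (raw)]:
  assumes [measurable]: "f \<in> borel_measurable M" "g \<in> borel_measurable M"
  shows "(\<lambda>x. spin_kernel \<beta> (f x) (g x)) \<in> borel_measurable M"
  unfolding spin_kernel_def by measurable

text \<open>The integrated variable is the first argument of the kernel, so a density is pushed
  forward by one step of the chain; as the kernel is symmetric, the same operator serves both ends
  of a block.\<close>

definition transfer :: "real \<Rightarrow> (real^3 \<Rightarrow> real) \<Rightarrow> real^3 \<Rightarrow> real"
  where "transfer \<beta> \<alpha> x = (LINT y|S2_area. \<alpha> y * spin_kernel \<beta> y x)"

text \<open>The bound is imposed on \<open>S2\<close> only, because the kernel grows without bound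
  off the sphere. Nonnegativity holds everywhere, so products can be split in \<open>ennreal\<close>
  without membership conditions.\<close>

definition bounded_density :: "(real^3 \<Rightarrow> real) \<Rightarrow> bool"
  where "bounded_density \<alpha> \<longleftrightarrow>
    \<alpha> \<in> borel_measurable borel \<and> (\<forall>x. 0 \<le> \<alpha> x) \<and> (\<exists>C. \<forall>x\<in>S2. \<alpha> x \<le> C)"

lemma bounded_density_const: "0 \<le> c \<Longrightarrow> bounded_density (\<lambda>_. c)"
  by (auto simp: bounded_density_def)

lemma bounded_densityD[measurable_dest]: "bounded_density \<alpha> \<Longrightarrow> \<alpha> \<in> borel_measurable borel"
  and bounded_density_nonneg: "bounded_density \<alpha> \<Longrightarrow> 0 \<le> \<alpha> x"
  by (auto simp: bounded_density_def)

lemma bounded_density_bound: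
  assumes "bounded_density \<alpha>"
  obtains C where "\<And>x. x \<in> S2 \<Longrightarrow> \<alpha> x \<le> C" "0 \<le> C"
proof -
  obtain C where C: "\<And>x. x \<in> S2 \<Longrightarrow> \<alpha> x \<le> C"
    using assms by (auto simp: bounded_density_def)
  show thesis
    by (rule that[of "max C 0"]) (auto simp: le_max_iff_disj C)
qed

lemma integrable_S2_area_bounded:
  fixes f :: "real^3 \<Rightarrow> real"
  assumes "f \<in> borel_measurable S2_area" "\<And>x. x \<in> S2 \<Longrightarrow> \<bar>f x\<bar> \<le> C"
  shows "integrable S2_area f"
  by (rule S2_area.integrable_const_bound[where B = C]) (use assms in auto)

lemma integral_S2_area_const: "(LINT x|S2_area. c) = 4 * pi * c"
  using measure_S2_area by simp

context
  fixes \<beta> :: real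
  assumes \<beta>: "0 < \<beta>"
begin

lemma spin_kernel_nonneg: "0 \<le> spin_kernel \<beta> s t"
  using \<beta> by (simp add: spin_kernel_def)

lemma spin_kernel_le:
  assumes "s \<in> S2" "t \<in> S2"
  shows "spin_kernel \<beta> s t \<le> (1 + 2 * \<beta>) / (4 * pi)"
proof -
  have "((1 + s \<bullet> t) / 2) powr (2 * \<beta>) \<le> 1"
    using abs_inner_S2_le[OF assms] \<beta> by (intro powr_le1) auto
  then show ?thesis
    using \<beta> unfolding spin_kernel_def by (intro mult_left_le) auto
qed

lemma abs_spin_kernel_le:
  assumes "s \<in> S2" "t \<in> S2"
  shows "\<bar>spin_kernel \<beta> s t\<bar> \<le> (1 + 2 * \<beta>) / (4 * pi)"
  using spin_kernel_le[OF assms] spin_kernel_nonneg[of s t] by simp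

lemma spin_kernel_bound:
  obtains D where "0 \<le> D" "\<And>s t. s \<in> S2 \<Longrightarrow> t \<in> S2 \<Longrightarrow> spin_kernel \<beta> s t \<le> D"
  using spin_kernel_le \<beta> by (intro that[of "(1 + 2 * \<beta>) / (4 * pi)"]) auto

lemma bounded_density_spin_kernel: "u \<in> S2 \<Longrightarrow> bounded_density (spin_kernel \<beta> u)"
  unfolding bounded_density_def using spin_kernel_nonneg spin_kernel_le[of u]
  by (auto intro: exI[of _ "(1 + 2 * \<beta>) / (4 * pi)"])

lemma nn_integral_spin_kernel:
  assumes "u \<in> S2"
  shows "(\<integral>\<^sup>+\<sigma>. ennreal (spin_kernel \<beta> u \<sigma>) \<partial>S2_area) = 1"
proof -
  have "(\<integral>\<^sup>+\<sigma>. ennreal (spin_kernel \<beta> u \<sigma>) \<partial>S2_area) =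
      ennreal ((1 + 2 * \<beta>) / (4 * pi)) * (\<integral>\<^sup>+\<sigma>. ennreal (((1 + u \<bullet> \<sigma>) / 2) powr (2 * \<beta>)) \<partial>S2_area)"
    using \<beta> by (subst nn_integral_cmult[symmetric]) (auto simp: spin_kernel_def simp flip: ennreal_mult)
  then show ?thesis
    using \<beta> assms by (simp add: nn_integral_S2_kernel_power flip: ennreal_mult ennreal_1)
qed

lemma integrable_spin_kernel: "u \<in> S2 \<Longrightarrow> integrable S2_area (spin_kernel \<beta> u)"
  by (rule integrable_S2_area_bounded[OF _ abs_spin_kernel_le]) auto

lemma integral_spin_kernel: "u \<in> S2 \<Longrightarrow> (LINT \<sigma>|S2_area. spin_kernel \<beta> u \<sigma>) = 1"
  using nn_integral_spin_kernel[of u] spin_kernel_nonneg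
  by (subst integral_eq_nn_integral) auto

lemma integrable_transfer:
  assumes "bounded_density \<alpha>" "x \<in> S2"
  shows "integrable S2_area (\<lambda>y. \<alpha> y * spin_kernel \<beta> y x)"
proof -
  note bounded_densityD[OF assms(1), measurable]
  obtain C where C: "\<And>x. x \<in> S2 \<Longrightarrow> \<alpha> x \<le> C" "0 \<le> C"
    using bounded_density_bound[OF assms(1)] by blast
  obtain D where D: "0 \<le> D" "\<And>s t. s \<in> S2 \<Longrightarrow> t \<in> S2 \<Longrightarrow> spin_kernel \<beta> s t \<le> D"
    by (rule spin_kernel_bound) blast
  show ?thesis
    using assms D spin_kernel_nonneg bounded_density_nonneg[OF assms(1)] C
    by (intro integrable_S2_area_bounded[where C = "C * D"]) (auto simp: abs_mult intro!: mult_mono)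
qed

lemma ennreal_transfer:
  assumes "bounded_density \<alpha>" "x \<in> S2"
  shows "(\<integral>\<^sup>+y. ennreal (\<alpha> y * spin_kernel \<beta> y x) \<partial>S2_area) = ennreal (transfer \<beta> \<alpha> x)"
  unfolding transfer_def using spin_kernel_nonneg bounded_density_nonneg[OF assms(1)]
  by (intro nn_integral_eq_integral integrable_transfer assms) auto

lemma bounded_density_transfer:
  assumes \<alpha>: "bounded_density \<alpha>"
  shows "bounded_density (transfer \<beta> \<alpha>)"
proof -
  note bounded_densityD[OF \<alpha>, measurable]
  obtain C where C: "\<And>x. x \<in> S2 \<Longrightarrow> \<alpha> x \<le> C" "0 \<le> C"
    using bounded_density_bound[OF \<alpha>] by blast
  have "transfer \<beta> \<alpha> x \<le> C" if x: "x \<in> S2" for x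
  proof -
    have "transfer \<beta> \<alpha> x \<le> (LINT y|S2_area. C * spin_kernel \<beta> x y)"
      unfolding transfer_def spin_kernel_commute[of \<beta> _ x]
      using integrable_transfer[OF \<alpha> x] integrable_spin_kernel[OF x] C spin_kernel_nonneg
      by (intro integral_mono) (auto simp: spin_kernel_commute[of \<beta> _ x] intro!: mult_right_mono)
    then show ?thesis
      by (simp add: integral_spin_kernel x)
  qed
  moreover have "transfer \<beta> \<alpha> \<in> borel_measurable borel"
    unfolding transfer_def by measurable
  moreover have "0 \<le> transfer \<beta> \<alpha> x" for x
    unfolding transfer_def using spin_kernel_nonneg bounded_density_nonneg[OF \<alpha>]
    by (intro Bochner_Integration.integral_nonneg) auto
  ultimately show ?thesis
    by (auto simp: bounded_density_def)
qed

lemma bounded_density_funpow_transfer: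
  "bounded_density \<alpha> \<Longrightarrow> bounded_density ((transfer \<beta> ^^ k) \<alpha>)"
  by (induction k) (auto intro: bounded_density_transfer)

text \<open>Values off the sphere do not matter to \<open>transfer\<close>. This lets identities
  that hold only on \<open>S2\<close>, such as the invariance of constants, be iterated.\<close>

lemma transfer_cong: "(\<And>y. y \<in> S2 \<Longrightarrow> \<alpha> y = \<gamma> y) \<Longrightarrow> transfer \<beta> \<alpha> x = transfer \<beta> \<gamma> x"
  unfolding transfer_def by (intro Bochner_Integration.integral_cong) auto

lemma transfer_const: "x \<in> S2 \<Longrightarrow> transfer \<beta> (\<lambda>_. c) x = c"
  unfolding transfer_def spin_kernel_commute[of \<beta> _ x] by (simp add: integral_spin_kernel)

lemma funpow_transfer_const: "x \<in> S2 \<Longrightarrow> (transfer \<beta> ^^ k) (\<lambda>_. c) x = c"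
proof (induction k arbitrary: x)
  case (Suc k)
  have "(transfer \<beta> ^^ Suc k) (\<lambda>_. c) x = transfer \<beta> (\<lambda>_. c) x"
    using Suc.IH by (auto intro!: transfer_cong)
  then show ?case
    using Suc.prems by (simp add: transfer_const)
qed simp

text \<open>By Fubini the new spin is integrated first and contributes 1. Conservation of mass keeps
  \<open>transfer_transfer_contraction\<close> applicable along the iteration.\<close>

lemma nn_integral_transfer:
  assumes \<alpha>: "bounded_density \<alpha>"
  shows "(\<integral>\<^sup>+x. ennreal (transfer \<beta> \<alpha> x) \<partial>S2_area) = (\<integral>\<^sup>+x. ennreal (\<alpha> x) \<partial>S2_area)"
proof -
  note bounded_densityD[OF \<alpha>, measurable]
  interpret pair_sigma_finite S2_area S2_area ..
  have "(\<integral>\<^sup>+x. ennreal (transfer \<beta> \<alpha> x) \<partial>S2_area) =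
      (\<integral>\<^sup>+x. \<integral>\<^sup>+y. ennreal (\<alpha> y * spin_kernel \<beta> y x) \<partial>S2_area \<partial>S2_area)"
    by (intro nn_integral_cong) (simp add: ennreal_transfer \<alpha>)
  also have "\<dots> = (\<integral>\<^sup>+y. \<integral>\<^sup>+x. ennreal (\<alpha> y * spin_kernel \<beta> y x) \<partial>S2_area \<partial>S2_area)"
    by (rule Fubini') measurable
  also have "\<dots> = (\<integral>\<^sup>+y. ennreal (\<alpha> y) * (\<integral>\<^sup>+x. ennreal (spin_kernel \<beta> y x) \<partial>S2_area) \<partial>S2_area)"
    using bounded_density_nonneg[OF \<alpha>] spin_kernel_nonneg
    by (subst nn_integral_cmult[symmetric]) (auto simp: ennreal_mult intro!: nn_integral_cong)
  also have "\<dots> = (\<integral>\<^sup>+x. ennreal (\<alpha> x) \<partial>S2_area)"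
    by (intro nn_integral_cong) (simp add: nn_integral_spin_kernel)
  finally show ?thesis .
qed

lemma integrable_bounded_density: "bounded_density \<alpha> \<Longrightarrow> integrable S2_area \<alpha>"
proof -
  assume \<alpha>: "bounded_density \<alpha>"
  note bounded_densityD[OF \<alpha>, measurable]
  obtain C where "\<And>x. x \<in> S2 \<Longrightarrow> \<alpha> x \<le> C" "0 \<le> C"
    using bounded_density_bound[OF \<alpha>] by blast
  then show ?thesis
    by (intro integrable_S2_area_bounded[where C = C]) (auto simp: bounded_density_nonneg[OF \<alpha>])
qed

lemma integral_funpow_transfer:
  assumes "bounded_density \<alpha>"
  shows "(LINT x|S2_area. (transfer \<beta> ^^ k) \<alpha> x) = (LINT x|S2_area. \<alpha> x)"
proof (induction k)
  case (Suc k)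
  let ?\<gamma> = "(transfer \<beta> ^^ k) \<alpha>"
  have "bounded_density ?\<gamma>"
    using assms by (rule bounded_density_funpow_transfer)
  note bd = this bounded_density_transfer[OF this]
  note bd[THEN bounded_densityD, measurable]
  have "(LINT x|S2_area. transfer \<beta> ?\<gamma> x) = (LINT x|S2_area. ?\<gamma> x)"
    using nn_integral_transfer[OF bd(1)] bd
    by (subst (1 2) integral_eq_nn_integral) (auto simp: bounded_density_nonneg)
  then show ?case
    using Suc.IH by simp
qed simp

section \<open>Doeblin minorisation and geometric convergence\<close>

definition minorant :: real
  where "minorant = 2 * pi * ((1 + 2 * \<beta>) / (4 * pi) * (1 / 4) powr (2 * \<beta>))\<^sup>2"

lemma minorant_pos: "0 < minorant"
  using \<beta> by (simp add: minorant_def)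

text \<open>The caps \<open>u \<bullet> z \<le> - 1 / 2\<close> and \<open>v \<bullet> z \<le> - 1 / 2\<close> have area \<open>pi\<close> each, so both kernels are
  bounded below on a set of area at least \<open>2 * pi\<close>.\<close>

lemma minorant_le:
  assumes u: "u \<in> S2" and v: "v \<in> S2"
  shows "minorant \<le> (LINT z|S2_area. spin_kernel \<beta> u z * spin_kernel \<beta> z v)"
proof -
  \<comment> \<open>Off the cap of \<open>w\<close> one has \<open>w \<bullet> z > - 1 / 2\<close>,
    that is \<open>(1 + w \<bullet> z) / 2 > 1 / 4\<close>, so \<open>?k\<close> bounds the kernel
    from below there; \<open>minorant\<close> is \<open>?k\<^sup>2\<close> times the area
    \<open>2 * pi\<close>.\<close>
  let ?k = "(1 + 2 * \<beta>) / (4 * pi) * (1 / 4) powr (2 * \<beta>)"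
  define cap where "cap w = {z \<in> S2. w \<bullet> z \<le> - (1 / 2)}" for w
  have cap[measurable]: "cap w \<in> sets S2_area" for w
  proof -
    have "{z \<in> space S2_area. w \<bullet> z \<le> - (1 / 2)} \<in> sets S2_area"
      by measurable
    then show ?thesis
      by (simp add: cap_def)
  qed
  have area: "measure S2_area (cap w) = pi" if "w \<in> S2" for w
  proof -
    have "emeasure S2_area (cap w) = (\<integral>\<^sup>+z. indicator {.. - (1 / 2)} (w \<bullet> z) \<partial>S2_area)"
      by (subst nn_integral_indicator[symmetric, OF cap], intro nn_integral_cong)
         (auto simp: cap_def indicator_def)
    also have "\<dots> = ennreal (2 * pi) * (\<integral>\<^sup>+c. indicator {.. - (1 / 2) :: real} c * indicator {-1..1} c \<partial>lborel)"
      by (rule nn_integral_S2_inner) (use that in auto)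
    also have "(\<integral>\<^sup>+c. indicator {.. - (1 / 2) :: real} c * indicator {-1..1} c \<partial>lborel) =
        (\<integral>\<^sup>+c. indicator {-1.. - (1 / 2) :: real} c \<partial>lborel)"
      by (intro nn_integral_cong) (auto simp: indicator_def)
    also have "\<dots> = ennreal (1 / 2)"
      by (simp add: emeasure_lborel_Icc del: ennreal_half)
    also have "ennreal (2 * pi) * ennreal (1 / 2) = ennreal pi"
      by (subst ennreal_mult[symmetric]) simp_all
    finally show ?thesis
      by (simp add: measure_def)
  qed
  define G where "G = S2 - (cap u \<union> cap v)"
  have G[measurable]: "G \<in> sets S2_area"
    using sets.top[of S2_area] unfolding G_def by auto
  have "measure S2_area (cap u \<union> cap v) \<le> 2 * pi"
    using measure_Un_le[OF cap cap, of u v] by (simp add: area u v)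
  then have "2 * pi \<le> measure S2_area G"
    using S2_area.finite_measure_compl[of "cap u \<union> cap v"] by (simp add: G_def measure_S2_area)
  moreover have "?k \<ge> 0"
    using \<beta> by simp
  ultimately have "minorant \<le> (LINT z|S2_area. ?k\<^sup>2 * indicator G z)"
    by (simp add: minorant_def G_def mult.commute[of "2 * pi"] mult_left_mono Int_absorb2 Diff_subset)
  also have "\<dots> \<le> (LINT z|S2_area. spin_kernel \<beta> u z * spin_kernel \<beta> z v)"
  proof (rule integral_mono)
    show "integrable S2_area (\<lambda>z. ?k\<^sup>2 * indicator G z)"
      by (intro integrable_mult_right) (simp add: less_top[symmetric])
    show "integrable S2_area (\<lambda>z. spin_kernel \<beta> u z * spin_kernel \<beta> z v)"
      using bounded_density_spin_kernel[OF u] v by (rule integrable_transfer)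
    show "?k\<^sup>2 * indicator G z \<le> spin_kernel \<beta> u z * spin_kernel \<beta> z v" if "z \<in> space S2_area" for z
    proof (cases "z \<in> G")
      case True
      have "?k \<le> spin_kernel \<beta> w z" if "z \<in> S2 - cap w" for w
        using that \<beta> unfolding spin_kernel_def cap_def
        by (intro mult_left_mono powr_mono2) auto
      from this[of u] this[of v] True have "?k * ?k \<le> spin_kernel \<beta> u z * spin_kernel \<beta> v z"
        using \<open>?k \<ge> 0\<close> by (intro mult_mono spin_kernel_nonneg) (auto simp: G_def)
      with True show ?thesis
        by (simp add: power2_eq_square spin_kernel_commute[of \<beta> z v])
    qed (simp add: spin_kernel_nonneg)
  qed
  finally show ?thesis .
qed

text \<open>Rewrites two steps as one integral against the two-step kernel, the quantity that
  \<open>minorant_le\<close> bounds from below. Fubini applies to a bounded integrand on a finite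
  measure space.\<close>

lemma transfer_transfer:
  assumes \<alpha>: "bounded_density \<alpha>" and x: "x \<in> S2"
  shows "transfer \<beta> (transfer \<beta> \<alpha>) x =
    (LINT y|S2_area. \<alpha> y * (LINT z|S2_area. spin_kernel \<beta> y z * spin_kernel \<beta> z x))"
proof -
  note bounded_densityD[OF \<alpha>, measurable]
  obtain C where C: "\<And>x. x \<in> S2 \<Longrightarrow> \<alpha> x \<le> C" "0 \<le> C"
    using bounded_density_bound[OF \<alpha>] by blast
  obtain D where D: "0 \<le> D" "\<And>s t. s \<in> S2 \<Longrightarrow> t \<in> S2 \<Longrightarrow> spin_kernel \<beta> s t \<le> D"
    by (rule spin_kernel_bound) blast
  interpret pair_sigma_finite S2_area S2_area ..
  interpret P: finite_measure "S2_area \<Otimes>\<^sub>M S2_area"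
    by (intro finite_measure_pair_measure S2_area.finite_measure_axioms)
  let ?f = "\<lambda>z y. \<alpha> y * spin_kernel \<beta> y z * spin_kernel \<beta> z x"
  have int: "integrable (S2_area \<Otimes>\<^sub>M S2_area) (\<lambda>(z, y). ?f z y)"
  proof (rule P.integrable_const_bound[where B = "C * D * D"])
    show "AE zy in S2_area \<Otimes>\<^sub>M S2_area. norm (case zy of (z, y) \<Rightarrow> ?f z y) \<le>
        C * D * D"
      using C x spin_kernel_nonneg D bounded_density_nonneg[OF \<alpha>]
      by (intro AE_I2) (auto simp: space_pair_measure abs_mult intro!: mult_mono)
  qed measurable
  have "transfer \<beta> (transfer \<beta> \<alpha>) x = (LINT z|S2_area. LINT y|S2_area. ?f z y)"
    unfolding transfer_def by simp
  also have "\<dots> = (LINT y|S2_area. LINT z|S2_area. ?f z y)"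
    by (rule Fubini_integral[OF int, symmetric])
  finally show ?thesis
    by (simp add: mult.assoc)
qed

text \<open>The deviation \<open>\<alpha> - 1 / (4 * pi)\<close> has integral 0, so subtracting the
  constant \<open>minorant\<close> from the two-step kernel changes nothing. What is left of the
  kernel is nonnegative and has mass \<open>1 - 4 * pi * minorant\<close>, the contraction
  factor.\<close>

lemma transfer_transfer_contraction:
  assumes \<alpha>: "bounded_density \<alpha>" and mass: "(LINT x|S2_area. \<alpha> x) = 1"
    and K: "\<And>y. y \<in> S2 \<Longrightarrow> \<bar>\<alpha> y - 1 / (4 * pi)\<bar> \<le> K" and x: "x \<in> S2"
  shows "\<bar>transfer \<beta> (transfer \<beta> \<alpha>) x - 1 / (4 * pi)\<bar> \<le> (1 - 4 * pi * minorant) * K"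
proof -
  define p2 where "p2 y = (LINT z|S2_area. spin_kernel \<beta> y z * spin_kernel \<beta> z x)" for y
  note bounded_densityD[OF \<alpha>, measurable]
  have p2: "p2 = transfer \<beta> (spin_kernel \<beta> x)"
    unfolding p2_def transfer_def by (auto simp: spin_kernel_commute mult.commute)
  have bd: "bounded_density p2"
    unfolding p2 by (intro bounded_density_transfer bounded_density_spin_kernel x)
  have int: "integrable S2_area p2"
    by (rule integrable_bounded_density[OF bd])
  have int1: "(LINT y|S2_area. p2 y) = 1"
    using integral_funpow_transfer[OF bounded_density_spin_kernel[OF x], of 1] integral_spin_kernel[OF x]
    by (simp add: p2)
  have ge: "minorant \<le> p2 y" if "y \<in> S2" for y
    unfolding p2_def by (rule minorant_le[OF that x])
  have i\<alpha>: "integrable S2_area (\<lambda>y. \<alpha> y * p2 y)"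
  proof -
    obtain C where C: "\<And>x. x \<in> S2 \<Longrightarrow> \<alpha> x \<le> C" "0 \<le> C"
      using bounded_density_bound[OF \<alpha>] by blast
    obtain D where D: "\<And>x. x \<in> S2 \<Longrightarrow> p2 x \<le> D" "0 \<le> D"
      using bounded_density_bound[OF bd] by blast
    show ?thesis
      using C D bounded_density_nonneg[OF bd] bounded_density_nonneg[OF \<alpha>] bounded_densityD[OF bd]
      by (intro integrable_S2_area_bounded[where C = "C * D"]) (auto simp: abs_mult intro!: mult_mono)
  qed
  \<comment> \<open>\<open>p2\<close> has mass 1, which accounts for the term
    \<open>1 / (4 * pi)\<close>; the two \<open>minorant\<close> terms cancel after
    integration.\<close>
  have "transfer \<beta> (transfer \<beta> \<alpha>) x - 1 / (4 * pi) =
      (LINT y|S2_area. \<alpha> y * p2 y - 1 / (4 * pi) * p2 y - minorant * \<alpha> y + minorant / (4 * pi))"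
    using int i\<alpha> integrable_bounded_density[OF \<alpha>]
    by (simp add: transfer_transfer[OF \<alpha> x] p2_def[symmetric] mass int1 measure_S2_area)
  also have "\<dots> = (LINT y|S2_area. (\<alpha> y - 1 / (4 * pi)) * (p2 y - minorant))"
    by (simp add: algebra_simps diff_divide_distrib)
  also have "\<bar>\<dots>\<bar> \<le> (LINT y|S2_area. K * (p2 y - minorant))"
  proof (rule integral_abs_bound_integral)
    show "integrable S2_area (\<lambda>y. (\<alpha> y - 1 / (4 * pi)) * (p2 y - minorant))"
      using int i\<alpha> integrable_bounded_density[OF \<alpha>] by (simp add: algebra_simps)
    show "integrable S2_area (\<lambda>y. K * (p2 y - minorant))"
      using int by simp
    show "\<bar>(\<alpha> y - 1 / (4 * pi)) * (p2 y - minorant)\<bar> \<le> K * (p2 y - minorant)" if "y \<in> space S2_area" for y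
      using K[of y] ge[of y] that by (simp add: abs_mult mult_right_mono)
  qed
  also have "\<dots> = (1 - 4 * pi * minorant) * K"
    using int by (simp add: int1 measure_S2_area algebra_simps)
  finally show ?thesis .
qed

text \<open>Nonnegativity of the contraction factor, read off from the contraction itself: for the
  uniform density and \<open>K = 1\<close> the left-hand side is an absolute value.\<close>

lemma minorant_le_1: "4 * pi * minorant \<le> 1"
proof -
  obtain x :: "real^3" where x: "x \<in> S2"
    using vector_choose_size[of 1] by (auto simp: mem_sphere_0)
  have "0 \<le> \<bar>transfer \<beta> (transfer \<beta> (\<lambda>_. 1 / (4 * pi))) x - 1 / (4 * pi)\<bar>"
    by simp
  also have "\<dots> \<le> (1 - 4 * pi * minorant) * 1"
    using x integral_S2_area_const[of "1 / (4 * pi)"]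
    by (intro transfer_transfer_contraction) (auto intro!: bounded_density_const)
  finally show ?thesis
    by simp
qed

text \<open>Each contraction consumes two steps, hence the even iterates. The bound is the same for
  all \<open>u\<close> and \<open>x\<close>; at \<open>n = 0\<close> it is the upper bound of the
  kernel, which dominates both nonnegative terms of the difference.\<close>

lemma funpow_transfer_converges:
  assumes u: "u \<in> S2" and x: "x \<in> S2"
  shows "\<bar>(transfer \<beta> ^^ (2 * n)) (spin_kernel \<beta> u) x - 1 / (4 * pi)\<bar> \<le>
    (1 - 4 * pi * minorant) ^ n * ((1 + 2 * \<beta>) / (4 * pi))"
  using x
proof (induction n arbitrary: x)
  case 0
  have "\<bar>a - b\<bar> \<le> c" if "0 \<le> a" "a \<le> c" "0 \<le> b" "b \<le> c" for a b c :: real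
    using that by linarith
  moreover have "1 / (4 * pi) \<le> (1 + 2 * \<beta>) / (4 * pi)" "0 \<le> 1 / (4 * pi)"
    using \<beta> by (auto intro!: divide_right_mono)
  ultimately show ?case
    using spin_kernel_nonneg[of u x] spin_kernel_le[OF u 0] by simp
next
  case (Suc n)
  have "\<bar>transfer \<beta> (transfer \<beta> ((transfer \<beta> ^^ (2 * n)) (spin_kernel \<beta> u))) x - 1 / (4 * pi)\<bar> \<le>
      (1 - 4 * pi * minorant) * ((1 - 4 * pi * minorant) ^ n * ((1 + 2 * \<beta>) / (4 * pi)))"
    using Suc u
    by (intro transfer_transfer_contraction bounded_density_funpow_transfer bounded_density_spin_kernel)
       (simp_all add: integral_funpow_transfer bounded_density_spin_kernel integral_spin_kernel)
  then show ?case
    by (simp add: mult.assoc)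
qed

text \<open>The starting point \<open>u n\<close> may change with \<open>n\<close>, as boundary
  spins do when the block grows; the uniform rate allows it.\<close>

lemma funpow_transfer_LIMSEQ:
  assumes u: "\<And>n. u n \<in> S2" and x: "x \<in> S2"
  shows "(\<lambda>n. (transfer \<beta> ^^ (2 * n)) (spin_kernel \<beta> (u n)) x) \<longlonglongrightarrow> 1 / (4 * pi)"
proof (rule LIM_zero_cancel, rule Lim_null_comparison)
  show "(\<lambda>n. (1 - 4 * pi * minorant) ^ n * ((1 + 2 * \<beta>) / (4 * pi))) \<longlonglongrightarrow> 0"
    using minorant_pos minorant_le_1 by (intro tendsto_mult_left_zero LIMSEQ_realpow_zero) auto
  show "\<forall>\<^sub>F n in sequentially. norm ((transfer \<beta> ^^ (2 * n)) (spin_kernel \<beta> (u n)) x - 1 / (4 * pi)) \<le>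
      (1 - 4 * pi * minorant) ^ n * ((1 + 2 * \<beta>) / (4 * pi))"
    using funpow_transfer_converges[OF u x] by (intro always_eventually) simp
qed

end

subsection \<open>Integrating out spins at the ends of a block\<close>

interpretation S2_prod: product_sigma_finite "\<lambda>_ :: int. S2_area"
  by standard

abbreviation block_measure :: "int set \<Rightarrow> (int \<Rightarrow> real^3) measure"
  where "block_measure I \<equiv> Pi\<^sub>M I (\<lambda>_. S2_area)"

lemma sets_block_measure: "sets (block_measure I) = sets (Pi\<^sub>M I (\<lambda>_. S2_borel))"
  by (intro sets_PiM_cong) (simp_all add: sets_S2_area)

lemma space_block_measure: "space (block_measure I) = I \<rightarrow>\<^sub>E S2"
  by (simp add: space_PiM)

lemma finite_block_measure: "finite I \<Longrightarrow> finite_measure (block_measure I)"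
proof (rule finite_measureI)
  assume "finite I"
  then have "emeasure (block_measure I) (I \<rightarrow>\<^sub>E S2) = (\<Prod>i\<in>I. emeasure S2_area S2)"
    using sets.top[of S2_area] by (intro S2_prod.emeasure_PiM) auto
  then show "emeasure (block_measure I) (space (block_measure I)) \<noteq> \<infinity>"
    using emeasure_S2_area by (simp add: space_PiM power_eq_top_ennreal)
qed

lemma borel_measurable_block_component[measurable]:
  assumes "i \<in> I"
  shows "(\<lambda>s. s i) \<in> borel_measurable (block_measure I)"
  using measurable_compose[OF measurable_component_singleton[OF assms] measurable_ident_S2(2)] by simp

lemma borel_measurable_chain_weight[measurable]:
  assumes "{n..m} \<subseteq> I"
  shows "chain_weight \<beta> n m \<in> borel_measurable (block_measure I)"
proof -
  have "(\<lambda>s. \<Prod>k\<in>{n..m - 1}. spin_kernel \<beta> (s k) (s (k + 1))) \<in> borel_measurable (block_measure I)"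
    by (intro borel_measurable_prod borel_measurable_spin_kernel borel_measurable_block_component)
       (use assms in auto)
  then show ?thesis
    unfolding chain_weight_def .
qed

lemma chain_weight_cong: "(\<And>i. i \<in> {n..m} \<Longrightarrow> s i = t i) \<Longrightarrow> chain_weight \<beta> n m s = chain_weight \<beta> n m t"
  unfolding chain_weight_def by (intro prod.cong) auto

lemma chain_weight_singleton[simp]: "chain_weight \<beta> n n s = 1"
  by (simp add: chain_weight_def)

lemma chain_weight_extend_left:
  assumes "n \<le> m"
  shows "chain_weight \<beta> (n - 1) m s = spin_kernel \<beta> (s (n - 1)) (s n) * chain_weight \<beta> n m s"
proof -
  have "{n - 1..m - 1} = insert (n - 1) {n..m - 1}"
    using assms by auto
  then show ?thesis
    by (simp add: chain_weight_def)
qed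

lemma chain_weight_extend_right:
  assumes "n \<le> m"
  shows "chain_weight \<beta> n (m + 1) s = chain_weight \<beta> n m s * spin_kernel \<beta> (s m) (s (m + 1))"
proof -
  have "{n..m} = insert m {n..m - 1}"
    using assms by auto
  then show ?thesis
    by (simp add: chain_weight_def mult.commute)
qed

text \<open>A chain with a density attached to each end. The DLR weights (boundary kernels at both
  ends) and the stationary marginals (\<open>1 / (4 * pi)\<close> and \<open>1\<close>) are
  instances, and integrating out an end spin only replaces a density by its
  \<open>transfer\<close>.\<close>

definition end_weight ::
    "real \<Rightarrow> (real^3 \<Rightarrow> real) \<Rightarrow> (real^3 \<Rightarrow> real) \<Rightarrow> int \<Rightarrow> int \<Rightarrow> (int \<Rightarrow> real^3) \<Rightarrow> real"
  where "end_weight \<beta> \<alpha> \<gamma> n m s = \<alpha> (s n) * chain_weight \<beta> n m s * \<gamma> (s m)"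

lemma borel_measurable_end_weight[measurable]:
  assumes "n \<le> m" "{n..m} \<subseteq> I" "bounded_density \<alpha>" "bounded_density \<gamma>"
  shows "end_weight \<beta> \<alpha> \<gamma> n m \<in> borel_measurable (block_measure I)"
proof -
  note assms(3,4)[THEN bounded_densityD, measurable]
  have [measurable]: "(\<lambda>s. s n) \<in> borel_measurable (block_measure I)"
    "(\<lambda>s. s m) \<in> borel_measurable (block_measure I)"
    "chain_weight \<beta> n m \<in> borel_measurable (block_measure I)"
    using assms by auto
  show ?thesis
    unfolding end_weight_def by measurable
qed

lemma boundary_weight_eq:
  "boundary_weight \<beta> a b u v s = end_weight \<beta> (spin_kernel \<beta> u) (spin_kernel \<beta> v) a b s"
  by (simp add: boundary_weight_def end_weight_def spin_kernel_commute[of \<beta> _ v])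

lemma measurable_restrict_block[measurable]:
  "J \<subseteq> I \<Longrightarrow> (\<lambda>s. restrict s J) \<in> block_measure I \<rightarrow>\<^sub>M block_measure J"
  by (rule measurable_restrict_subset)

context
  fixes \<beta> :: real
  assumes \<beta>: "0 < \<beta>"
begin

lemma chain_weight_nonneg: "0 \<le> chain_weight \<beta> n m s"
  unfolding chain_weight_def using spin_kernel_nonneg[OF \<beta>] by (intro prod_nonneg) auto

lemma end_weight_nonneg:
  "bounded_density \<alpha> \<Longrightarrow> bounded_density \<gamma> \<Longrightarrow> 0 \<le> end_weight \<beta> \<alpha> \<gamma> n m s"
  by (simp add: end_weight_def chain_weight_nonneg bounded_density_nonneg)

lemma chain_weight_bound:
  obtains C where "0 \<le> C" "\<And>s. s \<in> {n..m} \<rightarrow> S2 \<Longrightarrow> chain_weight \<beta> n m s \<le> C"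
proof -
  obtain D where D: "0 \<le> D" "\<And>s t. s \<in> S2 \<Longrightarrow> t \<in> S2 \<Longrightarrow> spin_kernel \<beta> s t \<le> D"
    by (rule spin_kernel_bound[OF \<beta>]) blast
  have "chain_weight \<beta> n m s \<le> (\<Prod>k\<in>{n..m - 1}. D)" if "s \<in> {n..m} \<rightarrow> S2" for s
    unfolding chain_weight_def using that D(2) spin_kernel_nonneg[OF \<beta>]
    by (intro prod_mono conjI) (auto simp: Pi_iff)
  moreover have "0 \<le> (\<Prod>k\<in>{n..m - 1}. D)"
    using D(1) by (intro prod_nonneg) auto
  ultimately show thesis
    using that by blast
qed

lemma end_weight_bound:
  assumes "n \<le> m" "bounded_density \<alpha>" "bounded_density \<gamma>"
  obtains C where "0 \<le> C" "\<And>s. s \<in> {n..m} \<rightarrow> S2 \<Longrightarrow> end_weight \<beta> \<alpha> \<gamma> n m s \<le> C"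
proof -
  obtain A where A: "\<And>x. x \<in> S2 \<Longrightarrow> \<alpha> x \<le> A" "0 \<le> A"
    using bounded_density_bound[OF assms(2)] by blast
  obtain B where B: "\<And>x. x \<in> S2 \<Longrightarrow> \<gamma> x \<le> B" "0 \<le> B"
    using bounded_density_bound[OF assms(3)] by blast
  obtain C where C: "0 \<le> C" "\<And>s. s \<in> {n..m} \<rightarrow> S2 \<Longrightarrow> chain_weight \<beta> n m s \<le> C"
    using chain_weight_bound by blast
  show thesis
  proof (rule that[of "A * C * B"])
    fix s :: "int \<Rightarrow> real^3"
    assume s: "s \<in> {n..m} \<rightarrow> S2"
    then have "s n \<in> S2" "s m \<in> S2"
      using assms(1) by auto
    then show "end_weight \<beta> \<alpha> \<gamma> n m s \<le> A * C * B"
      unfolding end_weight_def using A B C(1) C(2)[OF s] chain_weight_nonneg[of n m s] assms(2,3)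
      by (intro mult_mono mult_nonneg_nonneg) (auto simp: bounded_density_nonneg)
  qed (use A B C in auto)
qed

text \<open>The outermost spin occurs only in \<open>\<alpha> (s (n - 1))\<close> and in one bond,
  and their product integrates to \<open>transfer \<beta> \<alpha> (s n)\<close>. The restriction
  inside \<open>F\<close> hides the removed spin from the observable.\<close>

lemma nn_integral_extend_left:
  assumes nm: "n \<le> m" and \<alpha>: "bounded_density \<alpha>" and \<gamma>: "bounded_density \<gamma>"
    and F[measurable]: "F \<in> borel_measurable (block_measure {n..m})"
  shows "(\<integral>\<^sup>+s. F (restrict s {n..m}) * ennreal (end_weight \<beta> \<alpha> \<gamma> (n - 1) m s) \<partial>block_measure {n - 1..m}) =
    (\<integral>\<^sup>+s. F s * ennreal (end_weight \<beta> (transfer \<beta> \<alpha>) \<gamma> n m s) \<partial>block_measure {n..m})"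
proof -
  note \<alpha>[THEN bounded_densityD, measurable] \<gamma>[THEN bounded_densityD, measurable]
  have ins: "{n - 1..m} = insert (n - 1) {n..m}"
    using nm by auto
  have [measurable]: "end_weight \<beta> \<alpha> \<gamma> (n - 1) m \<in> borel_measurable (block_measure {n - 1..m})"
    "(\<lambda>s. restrict s {n..m}) \<in> block_measure {n - 1..m} \<rightarrow>\<^sub>M block_measure {n..m}"
    using nm \<alpha> \<gamma>
    by (intro borel_measurable_end_weight measurable_restrict_block; simp)+
  have "(\<integral>\<^sup>+s. F (restrict s {n..m}) * ennreal (end_weight \<beta> \<alpha> \<gamma> (n - 1) m s) \<partial>block_measure {n - 1..m}) =
      (\<integral>\<^sup>+s. \<integral>\<^sup>+y. F (restrict (s(n - 1 := y)) {n..m}) *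
        ennreal (end_weight \<beta> \<alpha> \<gamma> (n - 1) m (s(n - 1 := y))) \<partial>S2_area \<partial>block_measure {n..m})"
    unfolding ins by (rule S2_prod.product_nn_integral_insert) (auto simp flip: ins)
  also have "\<dots> = (\<integral>\<^sup>+s. F s * ennreal (end_weight \<beta> (transfer \<beta> \<alpha>) \<gamma> n m s) \<partial>block_measure {n..m})"
  proof (rule nn_integral_cong)
    fix s assume s: "s \<in> space (block_measure {n..m})"
    then have sn: "s n \<in> S2" and ext: "s \<in> extensional {n..m}"
      using nm by (auto simp: space_PiM PiE_iff)
    have res: "restrict (s(n - 1 := y)) {n..m} = s" for y
      using ext by (auto simp: fun_eq_iff restrict_def extensional_def)
    let ?c = "F s * ennreal (chain_weight \<beta> n m s * \<gamma> (s m))"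
    have chain: "chain_weight \<beta> n m (s(n - 1 := y)) = chain_weight \<beta> n m s" for y
      by (rule chain_weight_cong) auto
    have "F (restrict (s(n - 1 := y)) {n..m}) * ennreal (end_weight \<beta> \<alpha> \<gamma> (n - 1) m (s(n - 1 := y))) =
        ?c * ennreal (\<alpha> y * spin_kernel \<beta> y (s n))" for y
      unfolding res using nm chain_weight_nonneg spin_kernel_nonneg[OF \<beta>]
        bounded_density_nonneg[OF \<alpha>] bounded_density_nonneg[OF \<gamma>]
      by (simp add: end_weight_def chain_weight_extend_left chain ennreal_mult mult_ac)
    then have "(\<integral>\<^sup>+y. F (restrict (s(n - 1 := y)) {n..m}) *
        ennreal (end_weight \<beta> \<alpha> \<gamma> (n - 1) m (s(n - 1 := y))) \<partial>S2_area) =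
      ?c * (\<integral>\<^sup>+y. ennreal (\<alpha> y * spin_kernel \<beta> y (s n)) \<partial>S2_area)"
      by (subst nn_integral_cmult[symmetric]) auto
    also have "\<dots> = ?c * ennreal (transfer \<beta> \<alpha> (s n))"
      by (simp add: ennreal_transfer[OF \<beta> \<alpha> sn])
    also have "\<dots> = F s * ennreal (end_weight \<beta> (transfer \<beta> \<alpha>) \<gamma> n m s)"
      using chain_weight_nonneg bounded_density_nonneg[OF \<gamma>]
        bounded_density_nonneg[OF bounded_density_transfer[OF \<beta> \<alpha>]]
      by (simp add: end_weight_def ennreal_mult mult_ac)
    finally show "(\<integral>\<^sup>+y. F (restrict (s(n - 1 := y)) {n..m}) *
        ennreal (end_weight \<beta> \<alpha> \<gamma> (n - 1) m (s(n - 1 := y))) \<partial>S2_area) =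
      F s * ennreal (end_weight \<beta> (transfer \<beta> \<alpha>) \<gamma> n m s)" .
  qed
  finally show ?thesis .
qed

text \<open>Mirror image at the right end; symmetry of the kernel puts the last bond into the form
  that \<open>transfer\<close> expects.\<close>

lemma nn_integral_extend_right:
  assumes nm: "n \<le> m" and \<alpha>: "bounded_density \<alpha>" and \<gamma>: "bounded_density \<gamma>"
    and F[measurable]: "F \<in> borel_measurable (block_measure {n..m})"
  shows "(\<integral>\<^sup>+s. F (restrict s {n..m}) * ennreal (end_weight \<beta> \<alpha> \<gamma> n (m + 1) s) \<partial>block_measure {n..m + 1}) =
    (\<integral>\<^sup>+s. F s * ennreal (end_weight \<beta> \<alpha> (transfer \<beta> \<gamma>) n m s) \<partial>block_measure {n..m})"
proof -
  note \<alpha>[THEN bounded_densityD, measurable] \<gamma>[THEN bounded_densityD, measurable]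
  have ins: "{n..m + 1} = insert (m + 1) {n..m}"
    using nm by auto
  have [measurable]: "end_weight \<beta> \<alpha> \<gamma> n (m + 1) \<in> borel_measurable (block_measure {n..m + 1})"
    "(\<lambda>s. restrict s {n..m}) \<in> block_measure {n..m + 1} \<rightarrow>\<^sub>M block_measure {n..m}"
    using nm \<alpha> \<gamma>
    by (intro borel_measurable_end_weight measurable_restrict_block; simp)+
  have "(\<integral>\<^sup>+s. F (restrict s {n..m}) * ennreal (end_weight \<beta> \<alpha> \<gamma> n (m + 1) s) \<partial>block_measure {n..m + 1}) =
      (\<integral>\<^sup>+s. \<integral>\<^sup>+y. F (restrict (s(m + 1 := y)) {n..m}) *
        ennreal (end_weight \<beta> \<alpha> \<gamma> n (m + 1) (s(m + 1 := y))) \<partial>S2_area \<partial>block_measure {n..m})"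
    unfolding ins by (rule S2_prod.product_nn_integral_insert) (auto simp flip: ins)
  also have "\<dots> = (\<integral>\<^sup>+s. F s * ennreal (end_weight \<beta> \<alpha> (transfer \<beta> \<gamma>) n m s) \<partial>block_measure {n..m})"
  proof (rule nn_integral_cong)
    fix s assume s: "s \<in> space (block_measure {n..m})"
    then have sm: "s m \<in> S2" and ext: "s \<in> extensional {n..m}"
      using nm by (auto simp: space_PiM PiE_iff)
    have res: "restrict (s(m + 1 := y)) {n..m} = s" for y
      using ext by (auto simp: fun_eq_iff restrict_def extensional_def)
    let ?c = "F s * ennreal (\<alpha> (s n) * chain_weight \<beta> n m s)"
    have chain: "chain_weight \<beta> n m (s(m + 1 := y)) = chain_weight \<beta> n m s" for y
      by (rule chain_weight_cong) auto
    have "F (restrict (s(m + 1 := y)) {n..m}) * ennreal (end_weight \<beta> \<alpha> \<gamma> n (m + 1) (s(m + 1 := y))) =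
        ?c * ennreal (\<gamma> y * spin_kernel \<beta> y (s m))" for y
      unfolding res using nm chain_weight_nonneg spin_kernel_nonneg[OF \<beta>]
        bounded_density_nonneg[OF \<alpha>] bounded_density_nonneg[OF \<gamma>]
      by (simp add: end_weight_def chain_weight_extend_right chain ennreal_mult mult_ac spin_kernel_commute[of _ y])
    then have "(\<integral>\<^sup>+y. F (restrict (s(m + 1 := y)) {n..m}) *
        ennreal (end_weight \<beta> \<alpha> \<gamma> n (m + 1) (s(m + 1 := y))) \<partial>S2_area) =
      ?c * (\<integral>\<^sup>+y. ennreal (\<gamma> y * spin_kernel \<beta> y (s m)) \<partial>S2_area)"
      by (subst nn_integral_cmult[symmetric]) auto
    also have "\<dots> = ?c * ennreal (transfer \<beta> \<gamma> (s m))"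
      by (simp add: ennreal_transfer[OF \<beta> \<gamma> sm])
    also have "\<dots> = F s * ennreal (end_weight \<beta> \<alpha> (transfer \<beta> \<gamma>) n m s)"
      using chain_weight_nonneg bounded_density_nonneg[OF \<alpha>]
        bounded_density_nonneg[OF bounded_density_transfer[OF \<beta> \<gamma>]]
      by (simp add: end_weight_def ennreal_mult mult_ac)
    finally show "(\<integral>\<^sup>+y. F (restrict (s(m + 1 := y)) {n..m}) *
        ennreal (end_weight \<beta> \<alpha> \<gamma> n (m + 1) (s(m + 1 := y))) \<partial>S2_area) =
      F s * ennreal (end_weight \<beta> \<alpha> (transfer \<beta> \<gamma>) n m s)" .
  qed
  finally show ?thesis .
qed

text \<open>The outermost spin goes first, which applies \<open>transfer\<close> to
  \<open>\<alpha>\<close> before the remaining \<open>k\<close> steps; hence the induction over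
  arbitrary \<open>\<alpha>\<close>. The doubly restricted observable in the step is the given one,
  read as a function of the intermediate block.\<close>

lemma nn_integral_extend_left_funpow:
  assumes nm: "n \<le> m" and \<alpha>: "bounded_density \<alpha>" and \<gamma>: "bounded_density \<gamma>"
    and F[measurable]: "F \<in> borel_measurable (block_measure {n..m})"
  shows "(\<integral>\<^sup>+s. F (restrict s {n..m}) * ennreal (end_weight \<beta> \<alpha> \<gamma> (n - int k) m s) \<partial>block_measure {n - int k..m}) =
    (\<integral>\<^sup>+s. F s * ennreal (end_weight \<beta> ((transfer \<beta> ^^ k) \<alpha>) \<gamma> n m s) \<partial>block_measure {n..m})"
  using \<alpha>
proof (induction k arbitrary: \<alpha>)
  case 0
  show ?case
    by (simp only: of_nat_0 diff_zero add_0_right funpow_0, intro nn_integral_cong)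
       (simp only: space_block_measure PiE_restrict)
next
  case (Suc k)
  have [measurable]: "(\<lambda>s. restrict s {n..m}) \<in> block_measure {n - int k..m} \<rightarrow>\<^sub>M block_measure {n..m}"
    by (intro measurable_restrict_block) auto
  have "(\<integral>\<^sup>+s. F (restrict (restrict s {n - int k..m}) {n..m}) *
      ennreal (end_weight \<beta> \<alpha> \<gamma> (n - int k - 1) m s) \<partial>block_measure {n - int k - 1..m}) =
    (\<integral>\<^sup>+s. F (restrict s {n..m}) * ennreal (end_weight \<beta> (transfer \<beta> \<alpha>) \<gamma> (n - int k) m s) \<partial>block_measure {n - int k..m})"
    using nm Suc.prems \<gamma> by (intro nn_integral_extend_left) auto
  also have "\<dots> = (\<integral>\<^sup>+s. F s * ennreal (end_weight \<beta> ((transfer \<beta> ^^ k) (transfer \<beta> \<alpha>)) \<gamma> n m s) \<partial>block_measure {n..m})"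
    using Suc.prems by (intro Suc.IH bounded_density_transfer \<beta>)
  finally have "(\<integral>\<^sup>+s. F (restrict (restrict s {n - int k..m}) {n..m}) *
      ennreal (end_weight \<beta> \<alpha> \<gamma> (n - int k - 1) m s) \<partial>block_measure {n - int k - 1..m}) = (\<integral>\<^sup>+s. F s * ennreal (end_weight \<beta> ((transfer \<beta> ^^ k) (transfer \<beta> \<alpha>)) \<gamma> n m s) \<partial>block_measure {n..m})" .
  moreover have "n - int k - 1 = n - int (Suc k)" "{n - int k..m} \<inter> {n..m} = {n..m}"
    by auto
  ultimately show ?case
    by (simp only: restrict_restrict funpow_Suc_right o_apply)
qed

lemma nn_integral_extend_right_funpow:
  assumes nm: "n \<le> m" and \<alpha>: "bounded_density \<alpha>" and \<gamma>: "bounded_density \<gamma>"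
    and F[measurable]: "F \<in> borel_measurable (block_measure {n..m})"
  shows "(\<integral>\<^sup>+s. F (restrict s {n..m}) * ennreal (end_weight \<beta> \<alpha> \<gamma> n (m + int k) s) \<partial>block_measure {n..m + int k}) =
    (\<integral>\<^sup>+s. F s * ennreal (end_weight \<beta> \<alpha> ((transfer \<beta> ^^ k) \<gamma>) n m s) \<partial>block_measure {n..m})"
  using \<gamma>
proof (induction k arbitrary: \<gamma>)
  case 0
  show ?case
    by (simp only: of_nat_0 diff_zero add_0_right funpow_0, intro nn_integral_cong)
       (simp only: space_block_measure PiE_restrict)
next
  case (Suc k)
  have [measurable]: "(\<lambda>s. restrict s {n..m}) \<in> block_measure {n..m + int k} \<rightarrow>\<^sub>M block_measure {n..m}"
    by (intro measurable_restrict_block) auto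
  have "(\<integral>\<^sup>+s. F (restrict (restrict s {n..m + int k}) {n..m}) *
      ennreal (end_weight \<beta> \<alpha> \<gamma> n (m + int k + 1) s) \<partial>block_measure {n..m + int k + 1}) =
    (\<integral>\<^sup>+s. F (restrict s {n..m}) * ennreal (end_weight \<beta> \<alpha> (transfer \<beta> \<gamma>) n (m + int k) s) \<partial>block_measure {n..m + int k})"
    using nm Suc.prems \<alpha> by (intro nn_integral_extend_right) auto
  also have "\<dots> = (\<integral>\<^sup>+s. F s * ennreal (end_weight \<beta> \<alpha> ((transfer \<beta> ^^ k) (transfer \<beta> \<gamma>)) n m s) \<partial>block_measure {n..m})"
    using Suc.prems by (intro Suc.IH bounded_density_transfer \<beta>)
  finally have "(\<integral>\<^sup>+s. F (restrict (restrict s {n..m + int k}) {n..m}) *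
      ennreal (end_weight \<beta> \<alpha> \<gamma> n (m + int k + 1) s) \<partial>block_measure {n..m + int k + 1}) = (\<integral>\<^sup>+s. F s * ennreal (end_weight \<beta> \<alpha> ((transfer \<beta> ^^ k) (transfer \<beta> \<gamma>)) n m s) \<partial>block_measure {n..m})" .
  moreover have "m + int k + 1 = m + int (Suc k)" "{n..m + int k} \<inter> {n..m} = {n..m}"
    by auto
  ultimately show ?case
    by (simp only: restrict_restrict funpow_Suc_right o_apply)
qed

text \<open>As an equality of measures this serves twice: it reduces the DLR quotients to a fixed
  block, and it gives the consistency of the finite chains.\<close>

lemma distr_end_weight:
  assumes nm: "n \<le> m" and \<alpha>: "bounded_density \<alpha>" and \<gamma>: "bounded_density \<gamma>"
  shows "distr (density (block_measure {n - int k..m + int l}) (end_weight \<beta> \<alpha> \<gamma> (n - int k) (m + int l)))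
      (block_measure {n..m}) (\<lambda>s. restrict s {n..m}) =
    density (block_measure {n..m}) (end_weight \<beta> ((transfer \<beta> ^^ k) \<alpha>) ((transfer \<beta> ^^ l) \<gamma>) n m)"
    (is "distr ?L _ _ = ?R")
proof (rule measure_eqI)
  fix A assume "A \<in> sets (distr ?L (block_measure {n..m}) (\<lambda>s. restrict s {n..m}))"
  then have A[measurable]: "A \<in> sets (block_measure {n..m})"
    by simp
  have \<alpha>': "bounded_density ((transfer \<beta> ^^ k) \<alpha>)" and \<gamma>': "bounded_density ((transfer \<beta> ^^ l) \<gamma>)"
    using \<alpha> \<gamma> by (auto intro: bounded_density_funpow_transfer \<beta>)
  have [measurable]:
    "end_weight \<beta> \<alpha> \<gamma> (n - int k) (m + int l) \<in> borel_measurable (block_measure {n - int k..m + int l})"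
    "end_weight \<beta> ((transfer \<beta> ^^ k) \<alpha>) ((transfer \<beta> ^^ l) \<gamma>) n m \<in> borel_measurable (block_measure {n..m})"
    "(\<lambda>s. restrict s {n..m}) \<in> block_measure {n - int k..m + int l} \<rightarrow>\<^sub>M block_measure {n..m}"
    "(\<lambda>s. restrict s {n..m}) \<in> block_measure {n..m + int l} \<rightarrow>\<^sub>M block_measure {n..m}"
    using nm \<alpha> \<gamma> \<alpha>' \<gamma>'
    by (intro borel_measurable_end_weight measurable_restrict_block; simp)+
  have "emeasure (distr ?L (block_measure {n..m}) (\<lambda>s. restrict s {n..m})) A =
      (\<integral>\<^sup>+s. indicator A s \<partial>distr ?L (block_measure {n..m}) (\<lambda>s. restrict s {n..m}))"
    by simp
  also have "\<dots> = (\<integral>\<^sup>+s. indicator A (restrict s {n..m}) \<partial>?L)"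
    by (rule nn_integral_distr) auto
  also have "\<dots> = (\<integral>\<^sup>+s. ennreal (end_weight \<beta> \<alpha> \<gamma> (n - int k) (m + int l) s) * indicator A (restrict s {n..m})
      \<partial>block_measure {n - int k..m + int l})"
    by (rule nn_integral_density) auto
  also have "\<dots> = (\<integral>\<^sup>+s. indicator A (restrict (restrict s {n..m + int l}) {n..m}) *
      ennreal (end_weight \<beta> \<alpha> \<gamma> (n - int k) (m + int l) s) \<partial>block_measure {n - int k..m + int l})"
    by (simp add: restrict_restrict Int_absorb1 mult.commute)
  also have "\<dots> = (\<integral>\<^sup>+s. indicator A (restrict s {n..m}) *
      ennreal (end_weight \<beta> ((transfer \<beta> ^^ k) \<alpha>) \<gamma> n (m + int l) s) \<partial>block_measure {n..m + int l})"
    using nm \<alpha> \<gamma> by (intro nn_integral_extend_left_funpow) auto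
  also have "\<dots> = (\<integral>\<^sup>+s. indicator A s *
      ennreal (end_weight \<beta> ((transfer \<beta> ^^ k) \<alpha>) ((transfer \<beta> ^^ l) \<gamma>) n m s) \<partial>block_measure {n..m})"
    using nm \<alpha>' \<gamma> by (intro nn_integral_extend_right_funpow) auto
  also have "\<dots> = emeasure ?R A"
    by (simp add: emeasure_density mult.commute)
  finally show "emeasure (distr ?L (block_measure {n..m}) (\<lambda>s. restrict s {n..m})) A = emeasure ?R A" .
qed simp

text \<open>Going through the image measure asks only for measurability of \<open>f\<close>: the
  rules for integrals over image measures and over densities hold irrespective of
  integrability.\<close>

lemma integral_end_weight:
  assumes nm: "n \<le> m" and \<alpha>: "bounded_density \<alpha>" and \<gamma>: "bounded_density \<gamma>"
    and f[measurable]: "f \<in> borel_measurable (block_measure {n..m})"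
  shows "(LINT s|block_measure {n - int k..m + int l}. f (restrict s {n..m}) * end_weight \<beta> \<alpha> \<gamma> (n - int k) (m + int l) s) =
    (LINT s|block_measure {n..m}. f s * end_weight \<beta> ((transfer \<beta> ^^ k) \<alpha>) ((transfer \<beta> ^^ l) \<gamma>) n m s)"
proof -
  have \<alpha>': "bounded_density ((transfer \<beta> ^^ k) \<alpha>)" and \<gamma>': "bounded_density ((transfer \<beta> ^^ l) \<gamma>)"
    using \<alpha> \<gamma> by (auto intro: bounded_density_funpow_transfer \<beta>)
  have [measurable]:
    "end_weight \<beta> \<alpha> \<gamma> (n - int k) (m + int l) \<in> borel_measurable (block_measure {n - int k..m + int l})"
    "end_weight \<beta> ((transfer \<beta> ^^ k) \<alpha>) ((transfer \<beta> ^^ l) \<gamma>) n m \<in> borel_measurable (block_measure {n..m})"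
    "(\<lambda>s. restrict s {n..m}) \<in> block_measure {n - int k..m + int l} \<rightarrow>\<^sub>M block_measure {n..m}"
    using nm \<alpha> \<gamma> \<alpha>' \<gamma>'
    by (intro borel_measurable_end_weight measurable_restrict_block; simp)+
  let ?D = "density (block_measure {n - int k..m + int l}) (end_weight \<beta> \<alpha> \<gamma> (n - int k) (m + int l))"
  have "(LINT s|block_measure {n - int k..m + int l}. f (restrict s {n..m}) * end_weight \<beta> \<alpha> \<gamma> (n - int k) (m + int l) s) =
      (LINT s|?D. f (restrict s {n..m}))"
    using end_weight_nonneg[OF \<alpha> \<gamma>] by (subst integral_real_density) (auto simp: mult.commute)
  also have "\<dots> = (LINT s|distr ?D (block_measure {n..m}) (\<lambda>s. restrict s {n..m}). f s)"
    by (rule integral_distr[symmetric]) measurable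
  also have "\<dots> = (LINT s|block_measure {n..m}. f s * end_weight \<beta> ((transfer \<beta> ^^ k) \<alpha>) ((transfer \<beta> ^^ l) \<gamma>) n m s)"
    unfolding distr_end_weight[OF nm \<alpha> \<gamma>]
    using end_weight_nonneg[OF \<alpha>' \<gamma>'] by (subst integral_real_density) (auto simp: mult.commute)
  finally show ?thesis .
qed

end

subsection \<open>Expectations under Gibbs measures\<close>

lemma space_config_space: "space config_space = UNIV \<rightarrow>\<^sub>E S2"
  by (simp add: config_space_def space_PiM space_restrict_space)

lemma bounded_continuous_bound:
  assumes "bounded_continuous a b f"
  obtains B where "0 \<le> B" "\<And>s. s \<in> {a..b} \<rightarrow>\<^sub>E S2 \<Longrightarrow> \<bar>f s\<bar> \<le> B"
proof -
  obtain B where B: "\<And>s. s \<in> {a..b} \<rightarrow>\<^sub>E S2 \<Longrightarrow> \<bar>f s\<bar> \<le> B"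
    using assms by (force simp: bounded_continuous_def bounded_iff)
  show thesis
    by (rule that[of "max B 0"]) (auto simp: le_max_iff_disj B)
qed

text \<open>Makes an observable of a block an admissible test function for the DLR condition on
  every larger block.\<close>

lemma bounded_continuous_restrict:
  assumes f: "bounded_continuous n m f" and sub: "{n..m} \<subseteq> {a..b}"
  shows "bounded_continuous a b (\<lambda>s. f (restrict s {n..m}))"
proof -
  have "continuous_map (product_topology (\<lambda>_. top_of_set S2) {a..b})
      (product_topology (\<lambda>_. top_of_set S2) {n..m}) (\<lambda>s. restrict s {n..m})"
    using sub by (auto simp: continuous_map_componentwise intro!: continuous_map_product_projection)
  then have "continuous_map (product_topology (\<lambda>_. top_of_set S2) {a..b}) euclideanreal (f \<circ> (\<lambda>s. restrict s {n..m}))"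
    using f by (auto simp: bounded_continuous_def intro: continuous_map_compose)
  moreover have "(\<lambda>s. f (restrict s {n..m})) ` ({a..b} \<rightarrow>\<^sub>E S2) \<subseteq> f ` ({n..m} \<rightarrow>\<^sub>E S2)"
    using sub by (auto intro!: imageI simp: restrict_PiE_iff PiE_iff)
  ultimately show ?thesis
    using f unfolding bounded_continuous_def o_def by (auto intro: bounded_subset)
qed

text \<open>Continuity refers to the product topology over the block, measurability to the product
  sigma-algebra. The link is the function type \<open>int \<Rightarrow> real^3\<close>: its index
  set is countable, so coordinatewise measurability is Borel measurability there.\<close>

lemma borel_measurable_bounded_continuous:
  assumes f: "bounded_continuous a b f"
  shows "f \<in> borel_measurable (block_measure {a..b})"
proof -
  \<comment> \<open>\<open>X\<close> constrains the coordinates in the block only: tuples are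
    \<open>undefined\<close> elsewhere, and that value need not lie on the sphere.\<close>
  define X where "X = {s :: int \<Rightarrow> real^3. \<forall>i\<in>{a..b}. s i \<in> S2}"
  have "continuous_map (top_of_set X) (product_topology (\<lambda>_. top_of_set S2) {a..b}) (\<lambda>s. restrict s {a..b})"
    unfolding continuous_map_componentwise
  proof (intro conjI ballI)
    fix i assume i: "i \<in> {a..b}"
    have "continuous_on X (\<lambda>s. s i)"
      by (rule continuous_on_subset[OF continuous_on_product_coordinates]) simp
    then have "continuous_map (top_of_set X) (top_of_set S2) (\<lambda>s. s i)"
      using i by (auto simp: continuous_map_in_subtopology X_def)
    then show "continuous_map (top_of_set X) (top_of_set S2) (\<lambda>s. restrict s {a..b} i)"
      using i by simp
  qed auto
  then have "continuous_map (top_of_set X) euclideanreal (f \<circ> (\<lambda>s. restrict s {a..b}))"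
    using f unfolding bounded_continuous_def by (blast intro: continuous_map_compose)
  then have "continuous_on X (\<lambda>s. f (restrict s {a..b}))"
    by (simp only: o_def continuous_map_iff_continuous)
  then have *: "(\<lambda>s. f (restrict s {a..b})) \<in> borel_measurable (restrict_space borel X)"
    by (rule borel_measurable_continuous_on_restrict)
  have "(\<lambda>s. s) \<in> block_measure {a..b} \<rightarrow>\<^sub>M restrict_space borel X"
  proof (rule measurable_restrict_space2)
    show "(\<lambda>s. s) \<in> space (block_measure {a..b}) \<rightarrow> X"
      by (auto simp: space_PiM X_def)
    show "(\<lambda>s. s) \<in> borel_measurable (block_measure {a..b})"
    proof (rule measurable_coordinatewise_then_product)
      fix i
      show "(\<lambda>s. s i) \<in> borel_measurable (block_measure {a..b})"
      proof (cases "i \<in> {a..b}")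
        case False
        then have "s i = undefined" if "s \<in> space (block_measure {a..b})" for s
          using that by (auto simp: space_PiM PiE_iff extensional_def)
        then show ?thesis
          by (subst measurable_cong[of _ _ "\<lambda>_. undefined"]) auto
      qed (rule borel_measurable_block_component)
    qed
  qed
  from measurable_compose[OF this *]
  have "(\<lambda>s. f (restrict s {a..b})) \<in> borel_measurable (block_measure {a..b})" .
  then show ?thesis
    by (rule measurable_cong[THEN iffD1, rotated]) (simp only: space_block_measure PiE_restrict)
qed

lemma measurable_config_component[measurable]: "(\<lambda>S. S i) \<in> config_space \<rightarrow>\<^sub>M S2_borel"
  unfolding config_space_def by (rule measurable_component_singleton) simp

lemma measurable_config_restrict: "(\<lambda>S. restrict S I) \<in> config_space \<rightarrow>\<^sub>M block_measure I"
  unfolding config_space_def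
  by (subst measurable_cong_sets[OF refl sets_block_measure]) (rule measurable_restrict_subset, simp)

lemma subalgebra_boundary_algebra:
  assumes "sets M = sets config_space"
  shows "subalgebra M (boundary_algebra a b)"
  unfolding subalgebra_def boundary_algebra_def
proof
  show "space (vimage_algebra (space config_space) (\<lambda>S. (S (a - 1), S (b + 1))) (S2_borel \<Otimes>\<^sub>M S2_borel)) = space M"
    using sets_eq_imp_space_eq[OF assms] by simp
  have "(\<lambda>S. (S (a - 1), S (b + 1))) \<in> config_space \<rightarrow>\<^sub>M S2_borel \<Otimes>\<^sub>M S2_borel"
    by measurable
  then show "sets (vimage_algebra (space config_space) (\<lambda>S. (S (a - 1), S (b + 1))) (S2_borel \<Otimes>\<^sub>M S2_borel)) \<subseteq> sets M"
    unfolding assms by (intro sets_image_in_sets) auto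
qed

lemma emeasure_block_singleton: "emeasure (block_measure {n}) (space (block_measure {n})) = ennreal (4 * pi)"
  using S2_prod.emeasure_PiM[of "{n}" "\<lambda>_. S2"] sets.top[of S2_area] emeasure_S2_area
  by (simp add: space_PiM)

context
  fixes \<beta> :: real
  assumes \<beta>: "0 < \<beta>"
begin

text \<open>All spins but the leftmost are integrated out from the right. The constant 1 is fixed by
  \<open>transfer\<close> on the sphere, and the last spin contributes the area.\<close>

lemma integral_chain_weight:
  assumes "n \<le> m"
  shows "(LINT s|block_measure {n..m}. chain_weight \<beta> n m s) = 4 * pi"
proof -
  define l where "l = nat (m - n)"
  have m: "m = n + int l"
    using assms by (simp add: l_def)
  have one: "bounded_density (\<lambda>_. 1)"
    by (simp add: bounded_density_const)
  have "(LINT s|block_measure {n..m}. chain_weight \<beta> n m s) =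
      (LINT s|block_measure {n - int 0..n + int l}. 1 * end_weight \<beta> (\<lambda>_. 1) (\<lambda>_. 1) (n - int 0) (n + int l) s)"
    by (simp add: end_weight_def m)
  also have "\<dots> = (LINT s|block_measure {n..n}. 1 * end_weight \<beta> ((transfer \<beta> ^^ 0) (\<lambda>_. 1)) ((transfer \<beta> ^^ l) (\<lambda>_. 1)) n n s)"
    by (rule integral_end_weight[OF \<beta> _ one one]) auto
  also have "\<dots> = (LINT s|block_measure {n..n}. 1)"
    by (intro Bochner_Integration.integral_cong)
       (auto simp: end_weight_def space_PiM PiE_iff funpow_transfer_const[OF \<beta>])
  also have "\<dots> = 4 * pi"
    using emeasure_block_singleton[of n] by (simp add: measure_def)
  finally show ?thesis .
qed

text \<open>Each end density tends to \<open>1 / (4 * pi)\<close> on the sphere, whence the square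
  in the limit; uniform bounds on the densities and on the chain weight give a dominating
  constant.\<close>

lemma LIMSEQ_integral_end_weight:
  assumes nm: "n \<le> m" and u: "\<And>i. u i \<in> S2" and v: "\<And>i. v i \<in> S2"
    and f[measurable]: "f \<in> borel_measurable (block_measure {n..m})"
    and B: "\<And>s. s \<in> {n..m} \<rightarrow>\<^sub>E S2 \<Longrightarrow> \<bar>f s\<bar> \<le> B"
  shows "(\<lambda>i. LINT s|block_measure {n..m}. f s * end_weight \<beta>
      ((transfer \<beta> ^^ (2 * i)) (spin_kernel \<beta> (u i))) ((transfer \<beta> ^^ (2 * i)) (spin_kernel \<beta> (v i))) n m s)
    \<longlonglongrightarrow> (LINT s|block_measure {n..m}. f s * chain_weight \<beta> n m s) / (4 * pi)\<^sup>2"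
proof -
  let ?T = "\<lambda>i w. (transfer \<beta> ^^ (2 * i)) (spin_kernel \<beta> w)"
  \<comment> \<open>A bound for all iterates at once: the limit value plus the initial bound on the
    deviation, which never grows.\<close>
  define A where "A = 1 / (4 * pi) + (1 + 2 * \<beta>) / (4 * pi)"
  have A: "?T i w x \<le> A" if "w \<in> S2" "x \<in> S2" for i w x
  proof -
    have "(1 - 4 * pi * minorant \<beta>) ^ i * ((1 + 2 * \<beta>) / (4 * pi)) \<le> (1 + 2 * \<beta>) / (4 * pi)"
      using minorant_pos[OF \<beta>] minorant_le_1[OF \<beta>] \<beta> by (intro mult_left_le_one_le power_le_one) auto
    then show ?thesis
      using funpow_transfer_converges[OF \<beta> that, of i] by (simp add: A_def)
  qed
  have bd: "bounded_density (?T i w)" if "w \<in> S2" for i w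
    using that by (intro bounded_density_funpow_transfer bounded_density_spin_kernel \<beta>)
  obtain C where C: "0 \<le> C" "\<And>s. s \<in> {n..m} \<rightarrow> S2 \<Longrightarrow> chain_weight \<beta> n m s \<le> C"
    using chain_weight_bound[OF \<beta>] by blast
  interpret finite_measure "block_measure {n..m}"
    by (rule finite_block_measure) simp
  have [measurable]: "end_weight \<beta> (?T i (u i)) (?T i (v i)) n m \<in> borel_measurable (block_measure {n..m})" for i
    using nm u v by (intro borel_measurable_end_weight bd) auto
  have [measurable]: "chain_weight \<beta> n m \<in> borel_measurable (block_measure {n..m})"
    by (rule borel_measurable_chain_weight) simp
  have "(\<lambda>i. LINT s|block_measure {n..m}. f s * end_weight \<beta> (?T i (u i)) (?T i (v i)) n m s)
    \<longlonglongrightarrow> (LINT s|block_measure {n..m}. f s * chain_weight \<beta> n m s / (4 * pi)\<^sup>2)"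
  proof (rule integral_dominated_convergence[where w = "\<lambda>_. B * (A * C * A)"])
    show "AE s in block_measure {n..m}. (\<lambda>i. f s * end_weight \<beta> (?T i (u i)) (?T i (v i)) n m s)
        \<longlonglongrightarrow> f s * chain_weight \<beta> n m s / (4 * pi)\<^sup>2"
    proof (rule AE_I2)
      fix s assume "s \<in> space (block_measure {n..m})"
      then have s: "s n \<in> S2" "s m \<in> S2"
        using nm by (auto simp: space_PiM)
      have "(\<lambda>i. f s * end_weight \<beta> (?T i (u i)) (?T i (v i)) n m s)
          \<longlonglongrightarrow> f s * (1 / (4 * pi) * chain_weight \<beta> n m s * (1 / (4 * pi)))"
        unfolding end_weight_def
        by (intro tendsto_intros funpow_transfer_LIMSEQ \<beta> u v s)
      then show "(\<lambda>i. f s * end_weight \<beta> (?T i (u i)) (?T i (v i)) n m s)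
          \<longlonglongrightarrow> f s * chain_weight \<beta> n m s / (4 * pi)\<^sup>2"
        by (simp add: power2_eq_square)
    qed
    show "AE s in block_measure {n..m}. norm (f s * end_weight \<beta> (?T i (u i)) (?T i (v i)) n m s) \<le> B * (A * C * A)" for i
    proof (rule AE_I2)
      fix s assume "s \<in> space (block_measure {n..m})"
      then have s: "s \<in> {n..m} \<rightarrow>\<^sub>E S2" "s \<in> {n..m} \<rightarrow> S2" "s n \<in> S2" "s m \<in> S2"
        using nm by (auto simp: space_PiM)
      have "end_weight \<beta> (?T i (u i)) (?T i (v i)) n m s \<le> A * C * A"
        unfolding end_weight_def using C(1) C(2)[OF s(2)] A[OF u s(3), of i i] A[OF v s(4), of i i]
          bounded_density_nonneg[OF bd[OF u[of i], of i], of "s n"]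
          bounded_density_nonneg[OF bd[OF v[of i], of i], of "s m"] chain_weight_nonneg[OF \<beta>, of n m s]
        by (intro mult_mono mult_nonneg_nonneg) linarith+
      moreover have "0 \<le> end_weight \<beta> (?T i (u i)) (?T i (v i)) n m s"
        by (intro end_weight_nonneg \<beta> bd u v)
      ultimately show "norm (f s * end_weight \<beta> (?T i (u i)) (?T i (v i)) n m s) \<le> B * (A * C * A)"
        using B[OF s(1)] by (auto simp: abs_mult intro!: mult_mono)
    qed
  qed (use finite_measure_axioms in auto)
  then show ?thesis
    by simp
qed

lemma integrable_times_end_weight:
  assumes nm: "n \<le> m" and \<alpha>: "bounded_density \<alpha>" and \<gamma>: "bounded_density \<gamma>"
    and f[measurable]: "f \<in> borel_measurable (block_measure {n..m})"
    and B: "\<And>s. s \<in> {n..m} \<rightarrow>\<^sub>E S2 \<Longrightarrow> \<bar>f s\<bar> \<le> B"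
  shows "integrable (block_measure {n..m}) (\<lambda>s. f s * end_weight \<beta> \<alpha> \<gamma> n m s)"
proof -
  obtain C where C: "0 \<le> C" "\<And>s. s \<in> {n..m} \<rightarrow> S2 \<Longrightarrow> end_weight \<beta> \<alpha> \<gamma> n m s \<le> C"
    using end_weight_bound[OF \<beta> nm \<alpha> \<gamma>] by blast
  interpret finite_measure "block_measure {n..m}"
    by (rule finite_block_measure) simp
  have [measurable]: "end_weight \<beta> \<alpha> \<gamma> n m \<in> borel_measurable (block_measure {n..m})"
    using nm by (intro borel_measurable_end_weight \<alpha> \<gamma>) auto
  show ?thesis
  proof (rule integrable_const_bound[where B = "B * C"])
    show "AE s in block_measure {n..m}. norm (f s * end_weight \<beta> \<alpha> \<gamma> n m s) \<le> B * C"
    proof (rule AE_I2)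
      fix s assume "s \<in> space (block_measure {n..m})"
      then have s: "s \<in> {n..m} \<rightarrow>\<^sub>E S2" "s \<in> {n..m} \<rightarrow> S2"
        by (auto simp: space_PiM)
      then show "norm (f s * end_weight \<beta> \<alpha> \<gamma> n m s) \<le> B * C"
        using B[OF s(1)] C(1) C(2)[OF s(2)] end_weight_nonneg[OF \<beta> \<alpha> \<gamma>, of n m s]
        by (auto simp: abs_mult intro!: mult_mono)
    qed
  qed measurable
qed

text \<open>Bounds DLR quotients by \<open>B\<close>: this supplies the dominating function for the
  conditional expectations, and it shows that the numerator vanishes wherever the partition function
  does.\<close>

lemma abs_integral_end_weight_le:
  assumes nm: "n \<le> m" and \<alpha>: "bounded_density \<alpha>" and \<gamma>: "bounded_density \<gamma>"
    and f[measurable]: "f \<in> borel_measurable (block_measure {n..m})"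
    and B: "\<And>s. s \<in> {n..m} \<rightarrow>\<^sub>E S2 \<Longrightarrow> \<bar>f s\<bar> \<le> B"
  shows "\<bar>LINT s|block_measure {n..m}. f s * end_weight \<beta> \<alpha> \<gamma> n m s\<bar> \<le>
    B * (LINT s|block_measure {n..m}. end_weight \<beta> \<alpha> \<gamma> n m s)"
proof -
  have i: "integrable (block_measure {n..m}) (\<lambda>s. f s * end_weight \<beta> \<alpha> \<gamma> n m s)"
    "integrable (block_measure {n..m}) (\<lambda>s. B * end_weight \<beta> \<alpha> \<gamma> n m s)"
    using integrable_times_end_weight[OF nm \<alpha> \<gamma> f B]
      integrable_times_end_weight[OF nm \<alpha> \<gamma>, of "\<lambda>_. B" "\<bar>B\<bar>"] by simp_all
  have "\<bar>LINT s|block_measure {n..m}. f s * end_weight \<beta> \<alpha> \<gamma> n m s\<bar> \<le>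
      (LINT s|block_measure {n..m}. B * end_weight \<beta> \<alpha> \<gamma> n m s)"
    using i B end_weight_nonneg[OF \<beta> \<alpha> \<gamma>] by (intro order.trans[OF integral_abs_bound] integral_mono integrable_abs)
      (auto simp: space_block_measure abs_mult intro!: mult_right_mono)
  then show ?thesis
    by simp
qed

text \<open>Conditioning on the boundary of a block preserves the mean of the observable, while the
  conditional expectations converge almost surely to a constant. Dominated convergence identifies
  the mean with that constant.\<close>

lemma gibbs_expectation:
  assumes M: "gibbs_measure \<beta> M" and nm: "n \<le> m" and f: "bounded_continuous n m f"
  shows "(LINT S|M. f (restrict S {n..m})) =
    1 / (4 * pi) * (LINT s|block_measure {n..m}. f s * chain_weight \<beta> n m s)"
proof -
  interpret prob_space M
    using M by (simp add: gibbs_measure_def)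
  have sets_M: "sets M = sets config_space" and DLR: "DLR \<beta> M"
    using M by (auto simp: gibbs_measure_def)
  have space_M: "space M = UNIV \<rightarrow>\<^sub>E S2"
    using sets_eq_imp_space_eq[OF sets_M] by (simp add: space_config_space)
  obtain B where B: "0 \<le> B" "\<And>s. s \<in> {n..m} \<rightarrow>\<^sub>E S2 \<Longrightarrow> \<bar>f s\<bar> \<le> B"
    using bounded_continuous_bound[OF f] by blast
  have fm[measurable]: "f \<in> borel_measurable (block_measure {n..m})"
    by (rule borel_measurable_bounded_continuous[OF f])
  define g where "g S = f (restrict S {n..m})" for S
  have gm[measurable]: "g \<in> borel_measurable M"
    unfolding g_def measurable_cong_sets[OF sets_M refl]
    by (rule measurable_compose[OF measurable_config_restrict fm])
  have g_bound: "\<bar>g S\<bar> \<le> B" if "S \<in> space M" for S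
    unfolding g_def using that by (intro B) (auto simp: space_M)
  have g_int: "integrable M g"
    using g_bound by (intro integrable_const_bound[where B = B]) auto
  let ?T = "\<lambda>i w. (transfer \<beta> ^^ (2 * i)) (spin_kernel \<beta> w)"
  \<comment> \<open>The block grows by \<open>2 * i\<close> sites on either side because the
    convergence is known for even iterates.\<close>
  define a where "a i = n - int (2 * i)" for i
  define b where "b i = m + int (2 * i)" for i
  define num where "num h i u v = (LINT s|block_measure {n..m}. h s * end_weight \<beta> (?T i u) (?T i v) n m s)"
    for h i u v
  \<comment> \<open>The DLR quotient after the outer spins have been integrated out: it lives on the
    fixed block, and the boundary spins enter only through the end densities.\<close>
  define G where "G i S = num f i (S (a i - 1)) (S (b i + 1)) / num (\<lambda>_. 1) i (S (a i - 1)) (S (b i + 1))" for i S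
  define ce where "ce i = real_cond_exp M (boundary_algebra (a i) (b i)) g" for i
  have sub: "sigma_finite_subalgebra M (boundary_algebra (a i) (b i))" for i
    by (intro finite_measure_subalgebra_is_sigma_finite finite_measure_subalgebra.intro
        finite_measure_axioms finite_measure_subalgebra_axioms.intro subalgebra_boundary_algebra sets_M)
  have ew: "(LINT s|block_measure {a i..b i}. h (restrict s {n..m}) * boundary_weight \<beta> (a i) (b i) u v s) = num h i u v"
    if "u \<in> S2" "v \<in> S2" "h \<in> borel_measurable (block_measure {n..m})" for h i u v
    unfolding a_def b_def boundary_weight_eq num_def using nm that
    by (intro integral_end_weight \<beta> bounded_density_spin_kernel)
  have bd: "bounded_density (?T i w)" if "w \<in> S2" for i w
    using that by (intro bounded_density_funpow_transfer bounded_density_spin_kernel \<beta>)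
  have "AE S in M. ce i S = G i S" for i
  proof -
    have sub_ab: "{n..m} \<subseteq> {a i..b i}" and ab: "a i \<le> b i"
      using nm by (auto simp: a_def b_def)
    have "AE S in M. real_cond_exp M (boundary_algebra (a i) (b i))
        (\<lambda>S. f (restrict (restrict S {a i..b i}) {n..m})) S =
      1 / partition_fun \<beta> (a i) (b i) (S (a i - 1)) (S (b i + 1)) *
        (LINT s|block_measure {a i..b i}. f (restrict s {n..m}) *
          boundary_weight \<beta> (a i) (b i) (S (a i - 1)) (S (b i + 1)) s)"
      using DLR ab bounded_continuous_restrict[OF f sub_ab] unfolding DLR_def by blast
    moreover have "(\<lambda>S. f (restrict (restrict S {a i..b i}) {n..m})) = g"
      unfolding g_def restrict_restrict using sub_ab by (simp only: Int_absorb1)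
    ultimately have "AE S in M. ce i S =
        1 / partition_fun \<beta> (a i) (b i) (S (a i - 1)) (S (b i + 1)) *
        (LINT s|block_measure {a i..b i}. f (restrict s {n..m}) *
          boundary_weight \<beta> (a i) (b i) (S (a i - 1)) (S (b i + 1)) s)"
      by (simp only: ce_def)
    then show ?thesis
    proof (rule AE_mp, intro AE_I2 impI)
      fix S assume S: "S \<in> space M" and eq: "ce i S =
        1 / partition_fun \<beta> (a i) (b i) (S (a i - 1)) (S (b i + 1)) *
        (LINT s|block_measure {a i..b i}. f (restrict s {n..m}) *
          boundary_weight \<beta> (a i) (b i) (S (a i - 1)) (S (b i + 1)) s)"
      have uv: "S (a i - 1) \<in> S2" "S (b i + 1) \<in> S2"
        using S by (auto simp: space_M)
      show "ce i S = G i S"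
        unfolding eq ew[OF uv fm] G_def partition_fun_def
        using ew[OF uv, of "\<lambda>_. 1"] by simp
    qed
  qed
  \<comment> \<open>Each block has its own exceptional null set; the countably many are merged
    before the limit is taken.\<close>
  then have ce_G: "AE S in M. \<forall>i. ce i S = G i S"
    by (subst AE_all_countable) simp
  have "(\<lambda>i. LINT S|M. ce i S) \<longlonglongrightarrow>
      (LINT S|M. 1 / (4 * pi) * (LINT s|block_measure {n..m}. f s * chain_weight \<beta> n m s))"
  proof (rule integral_dominated_convergence[where w = "\<lambda>_. B"])
    show "ce i \<in> borel_measurable M" for i
      unfolding ce_def by (rule borel_measurable_cond_exp2)
    show "AE S in M. (\<lambda>i. ce i S) \<longlonglongrightarrow> 1 / (4 * pi) * (LINT s|block_measure {n..m}. f s * chain_weight \<beta> n m s)"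
      using ce_G
    proof (rule AE_mp, intro AE_I2 impI)
      fix S assume S: "S \<in> space M" and eq: "\<forall>i. ce i S = G i S"
      have uv: "S (a i - 1) \<in> S2" "S (b i + 1) \<in> S2" for i
        using S by (auto simp: space_M)
      have "(\<lambda>i. num f i (S (a i - 1)) (S (b i + 1))) \<longlonglongrightarrow>
          (LINT s|block_measure {n..m}. f s * chain_weight \<beta> n m s) / (4 * pi)\<^sup>2"
        unfolding num_def using uv B(2) by (intro LIMSEQ_integral_end_weight nm) auto
      moreover have "(\<lambda>i. num (\<lambda>_. 1) i (S (a i - 1)) (S (b i + 1))) \<longlonglongrightarrow>
          (LINT s|block_measure {n..m}. 1 * chain_weight \<beta> n m s) / (4 * pi)\<^sup>2"
        unfolding num_def using uv by (intro LIMSEQ_integral_end_weight[where B = 1] nm) auto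
      \<comment> \<open>The partition function tends to \<open>4 * pi / (4 * pi)\<^sup>2\<close>, so
        exactly one factor \<open>1 / (4 * pi)\<close> survives in the quotient.\<close>
      ultimately have "(\<lambda>i. G i S) \<longlonglongrightarrow>
          ((LINT s|block_measure {n..m}. f s * chain_weight \<beta> n m s) / (4 * pi)\<^sup>2) / (4 * pi / (4 * pi)\<^sup>2)"
        unfolding G_def by (intro tendsto_divide) (auto simp: integral_chain_weight[OF nm])
      then show "(\<lambda>i. ce i S) \<longlonglongrightarrow> 1 / (4 * pi) * (LINT s|block_measure {n..m}. f s * chain_weight \<beta> n m s)"
        using eq by simp
    qed
    show "AE S in M. norm (ce i S) \<le> B" for i
      using ce_G
    proof (rule AE_mp, intro AE_I2 impI)
      fix S assume S: "S \<in> space M" and eq: "\<forall>i. ce i S = G i S"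
      have uv: "S (a i - 1) \<in> S2" "S (b i + 1) \<in> S2"
        using S by (auto simp: space_M)
      let ?d = "num (\<lambda>_. 1) i (S (a i - 1)) (S (b i + 1))"
      have "\<bar>num f i (S (a i - 1)) (S (b i + 1))\<bar> \<le> B * ?d"
        using abs_integral_end_weight_le[OF nm bd[OF uv(1)] bd[OF uv(2)] fm B(2), of i i]
        by (simp add: num_def)
      moreover have "0 \<le> ?d"
        unfolding num_def using end_weight_nonneg[OF \<beta> bd[OF uv(1)] bd[OF uv(2)]]
        by (intro Bochner_Integration.integral_nonneg) auto
      \<comment> \<open>A vanishing denominator makes the quotient 0 by convention, which is within
        the bound.\<close>
      ultimately show "norm (ce i S) \<le> B"
        using eq B(1) by (cases "?d = 0") (auto simp: G_def divide_le_eq)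
    qed
  qed auto
  moreover have "(LINT S|M. ce i S) = (LINT S|M. g S)" for i
    unfolding ce_def by (rule sigma_finite_subalgebra.real_cond_exp_int(2)[OF sub g_int])
  ultimately have "(\<lambda>_ :: nat. LINT S|M. g S) \<longlonglongrightarrow>
      1 / (4 * pi) * (LINT s|block_measure {n..m}. f s * chain_weight \<beta> n m s)"
    by (simp add: prob_space)
  then show ?thesis
    unfolding g_def by (rule LIMSEQ_unique[OF tendsto_const])
qed

end

subsection \<open>Determination by local observables\<close>

lemma measurable_config_borel: "(\<lambda>S. S) \<in> borel_measurable config_space"
proof (rule measurable_coordinatewise_then_product)
  show "(\<lambda>S. S i) \<in> borel_measurable config_space" for i
    using measurable_compose[OF measurable_config_component measurable_ident_S2(1)] .
qed

text \<open>A total Borel map onto the sphere fixing its points, used to bring measures on products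
  of \<open>real^3\<close> back to products of spheres. The value off the sphere is an arbitrary
  point of it.\<close>

definition S2_retract :: "real^3 \<Rightarrow> real^3"
  where "S2_retract x = (if x \<in> S2 then x else axis 1 1)"

lemma S2_retract_in[simp]: "S2_retract x \<in> S2"
  by (simp add: S2_retract_def mem_sphere_0)

lemma S2_retract_id[simp]: "x \<in> S2 \<Longrightarrow> S2_retract x = x"
  by (simp add: S2_retract_def)

lemma measurable_S2_retract[measurable]: "S2_retract \<in> borel \<rightarrow>\<^sub>M S2_borel"
proof (rule measurable_restrict_space2)
  have [measurable]: "S2 \<in> sets borel"
    by simp
  show "S2_retract \<in> borel_measurable borel"
    unfolding S2_retract_def by measurable
qed auto

lemma measurable_S2_retract_config:
  "(\<lambda>\<omega> i. S2_retract (\<omega> i)) \<in> (\<Pi>\<^sub>M i\<in>UNIV. borel) \<rightarrow>\<^sub>M config_space"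
  unfolding config_space_def
  by (rule measurable_PiM_single')
     (auto intro!: measurable_compose[OF _ measurable_S2_retract])

text \<open>Filling the sites outside the block with \<open>0\<close> turns a continuous function of
  the whole configuration into a local observable. The filler is not on the sphere, but
  \<open>g\<close> is continuous and bounded on all of
  \<open>int \<Rightarrow> real^3\<close>.\<close>

lemma bounded_continuous_truncate:
  fixes g :: "(int \<Rightarrow> real^3) \<Rightarrow> real"
  assumes g: "continuous_on UNIV g" and B: "\<And>S. \<bar>g S\<bar> \<le> B"
  shows "bounded_continuous a b (\<lambda>s. g (\<lambda>i. if i \<in> {a..b} then s i else 0))"
proof -
  have "continuous_map (product_topology (\<lambda>_. top_of_set S2) {a..b}) euclidean
      (\<lambda>s i. if i \<in> {a..b} then s i else (0 :: real^3))"
    unfolding euclidean_product_topology[symmetric] continuous_map_componentwise_UNIV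
  proof
    fix i
    show "continuous_map (product_topology (\<lambda>_. top_of_set S2) {a..b}) euclidean
        (\<lambda>s. if i \<in> {a..b} then s i else (0 :: real^3))"
    proof (cases "i \<in> {a..b}")
      case True
      then have "continuous_map (product_topology (\<lambda>_. top_of_set S2) {a..b}) (top_of_set S2) (\<lambda>s. s i :: real^3)"
        by (rule continuous_map_product_projection)
      then show ?thesis
        using True by (auto dest: continuous_map_into_fulltopology)
    qed auto
  qed
  moreover have "continuous_map euclidean euclideanreal g"
    using g by simp
  ultimately have "continuous_map (product_topology (\<lambda>_. top_of_set S2) {a..b}) euclideanreal
      (g \<circ> (\<lambda>s i. if i \<in> {a..b} then s i else 0))"
    by (rule continuous_map_compose)
  then show ?thesis
    unfolding bounded_continuous_def o_def using B by (auto simp: bounded_iff)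
qed

text \<open>Set all spins outside a block to \<open>0\<close> and let the block grow.\<close>

lemma integral_eq_if_local_eq:
  fixes g :: "(int \<Rightarrow> real^3) \<Rightarrow> real"
  assumes M: "prob_space M" "sets M = sets config_space" and N: "prob_space N" "sets N = sets config_space"
    and eq: "\<And>n m f. n \<le> m \<Longrightarrow> bounded_continuous n m f \<Longrightarrow>
      (LINT S|M. f (restrict S {n..m})) = (LINT S|N. f (restrict S {n..m}))"
    and g: "continuous_on UNIV g" and B: "\<And>S. \<bar>g S\<bar> \<le> B"
  shows "(LINT S|M. g S) = (LINT S|N. g S)"
proof -
  define tr where "tr k S = (\<lambda>i. if i \<in> {- int k..int k} then S i else (0 :: real^3))" for k S
  have tr_restrict: "tr k (restrict S {- int k..int k}) = tr k S" for k S
    by (auto simp: tr_def)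
  \<comment> \<open>Every coordinate is eventually constant, which gives convergence in the product
    topology.\<close>
  have tr_lim: "(\<lambda>k. tr k S) \<longlonglongrightarrow> S" for S
  proof -
    have "(\<lambda>k. tr k S i) \<longlonglongrightarrow> S i" for i
    proof (rule tendsto_eventually)
      have "tr k S i = S i" if "k \<ge> nat \<bar>i\<bar>" for k
        using that by (auto simp: tr_def)
      then show "\<forall>\<^sub>F k in sequentially. tr k S i = S i"
        by (auto simp: eventually_sequentially)
    qed
    then have "limitin (product_topology (\<lambda>_. euclidean) UNIV) (\<lambda>k. tr k S) S sequentially"
      by (subst limitin_componentwise) auto
    then show ?thesis
      by (simp add: euclidean_product_topology)
  qed
  have lim: "(\<lambda>k. LINT S|L. g (tr k S)) \<longlonglongrightarrow> (LINT S|L. g S)"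
    if L: "prob_space L" "sets L = sets config_space" for L
  proof -
    interpret prob_space L by fact
    have id[measurable]: "(\<lambda>S. S) \<in> borel_measurable L"
      unfolding measurable_cong_sets[OF L(2) refl] by (rule measurable_config_borel)
    have [measurable]: "(\<lambda>S. S i) \<in> borel_measurable L" for i
      by (rule measurable_product_then_coordinatewise[OF id])
    have [measurable]: "tr k \<in> borel_measurable L" for k
      unfolding tr_def by (rule measurable_coordinatewise_then_product) measurable
    have [measurable]: "g \<in> borel_measurable borel"
      by (rule borel_measurable_continuous_onI[OF g])
    have [measurable]: "g \<in> borel_measurable L"
      using measurable_compose[OF id \<open>g \<in> borel_measurable borel\<close>] .
    have "isCont g S" for S
      using g by (simp add: continuous_on_eq_continuous_at)
    then show ?thesis
      using B tr_lim by (intro integral_dominated_convergence[where w = "\<lambda>_. B"])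
        (auto intro!: isCont_tendsto_compose[of _ g])
  qed
  have "(LINT S|M. g (tr k S)) = (LINT S|N. g (tr k S))" for k
    using eq[OF _ bounded_continuous_truncate[OF g B], of "- int k" "int k"]
    unfolding tr_def[symmetric] tr_restrict by simp
  then show ?thesis
    using lim[OF M] lim[OF N] by (auto intro: LIMSEQ_unique)
qed

text \<open>The indicator of a closed set is the pointwise limit of continuous functions that fall
  off linearly, ever more steeply, with the distance to the set.\<close>

lemma measure_closed_eq_if_integral_eq:
  fixes C :: "'a::metric_space set"
  assumes M: "prob_space M" "(\<lambda>x. x) \<in> borel_measurable M"
    and N: "prob_space N" "(\<lambda>x. x) \<in> borel_measurable N"
    and eq: "\<And>g :: 'a \<Rightarrow> real. continuous_on UNIV g \<Longrightarrow> (\<And>x. \<bar>g x\<bar> \<le> 1) \<Longrightarrow> (LINT x|M. g x) = (LINT x|N. g x)"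
    and C: "closed C"
  shows "measure (distr M borel (\<lambda>x. x)) C = measure (distr N borel (\<lambda>x. x)) C"
proof (cases "C = {}")
  case False
  \<comment> \<open>The empty set is treated apart because \<open>infdist x {}\<close> is 0, which
    would make every approximant constantly 1.\<close>
  define g where "g k x = max 0 (1 - real k * infdist x C)" for k x
  have g: "continuous_on UNIV (g k)" and g1: "\<bar>g k x\<bar> \<le> 1" for k x
    unfolding g_def by (auto intro!: continuous_intros simp: infdist_nonneg)
  have g_lim: "(\<lambda>k. g k x) \<longlonglongrightarrow> indicator C x" for x
  proof (cases "x \<in> C")
    case True
    then show ?thesis
      by (simp add: g_def)
  next
    case False
    then have "infdist x C > 0"
      using C \<open>C \<noteq> {}\<close> by (simp add: infdist_pos_not_in_closed)
    then obtain k0 where k0: "1 < real k0 * infdist x C"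
      using reals_Archimedean3 by blast
    have "g k x = 0" if "k \<ge> k0" for k
    proof -
      have "real k0 * infdist x C \<le> real k * infdist x C"
        using that \<open>infdist x C > 0\<close> by simp
      then show ?thesis
        using k0 by (simp add: g_def)
    qed
    then have "\<forall>\<^sub>F k in sequentially. g k x = indicator C x"
      using False by (auto simp: eventually_sequentially)
    then show ?thesis
      by (rule tendsto_eventually)
  qed
  have lim: "(\<lambda>k. LINT x|L. g k x) \<longlonglongrightarrow> measure (distr L borel (\<lambda>x. x)) C"
    if L: "prob_space L" "(\<lambda>x. x) \<in> borel_measurable L" for L
  proof -
    interpret D: prob_space "distr L borel (\<lambda>x. x)"
      using L by (rule prob_space.prob_space_distr)
    have gm: "g k \<in> borel_measurable borel" for k
      by (rule borel_measurable_continuous_onI[OF g])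
    have "(\<lambda>k. LINT x|distr L borel (\<lambda>x. x). g k x) \<longlonglongrightarrow> (LINT x|distr L borel (\<lambda>x. x). indicator C x)"
      using g1 g_lim gm C by (intro integral_dominated_convergence[where w = "\<lambda>_. 1"]) auto
    then show ?thesis
      using C by (simp add: integral_distr[OF L(2) gm])
  qed
  show ?thesis
    using lim[OF M] lim[OF N] eq[OF g g1] by (auto intro: LIMSEQ_unique)
qed simp

text \<open>Closed sets are stable under intersection and generate the Borel sets of
  \<open>int \<Rightarrow> real^3\<close>, so the two measures agree once they are transported
  there.\<close>

lemma config_measure_eqI:
  assumes M: "prob_space M" "sets M = sets config_space" and N: "prob_space N" "sets N = sets config_space"
    and eq: "\<And>n m f. n \<le> m \<Longrightarrow> bounded_continuous n m f \<Longrightarrow>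
      (LINT S|M. f (restrict S {n..m})) = (LINT S|N. f (restrict S {n..m}))"
  shows "M = N"
proof -
  have id: "(\<lambda>S. S) \<in> borel_measurable M" "(\<lambda>S. S) \<in> borel_measurable N"
    unfolding measurable_cong_sets[OF M(2) refl] measurable_cong_sets[OF N(2) refl]
    by (rule measurable_config_borel)+
  interpret M: prob_space "distr M borel (\<lambda>S. S)"
    using M(1) id(1) by (rule prob_space.prob_space_distr)
  interpret N: prob_space "distr N borel (\<lambda>S. S)"
    using N(1) id(2) by (rule prob_space.prob_space_distr)
  have "distr M borel (\<lambda>S. S) = distr N borel (\<lambda>S. S)"
  proof (rule measure_eqI_generator_eq[where E = "Collect closed" and \<Omega> = UNIV and A = "\<lambda>_. UNIV"])
    show "Int_stable (Collect closed :: (int \<Rightarrow> real^3) set set)"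
      by (auto simp: Int_stable_def)
    fix C :: "(int \<Rightarrow> real^3) set"
    assume "C \<in> Collect closed"
    then have "measure (distr M borel (\<lambda>S. S)) C = measure (distr N borel (\<lambda>S. S)) C"
      by (intro measure_closed_eq_if_integral_eq M(1) N(1) id integral_eq_if_local_eq[OF M N eq]) auto
    then show "emeasure (distr M borel (\<lambda>S. S)) C = emeasure (distr N borel (\<lambda>S. S)) C"
      by (simp add: M.emeasure_eq_measure N.emeasure_eq_measure)
  next
    show "sets (distr M borel (\<lambda>S. S)) = sigma_sets UNIV (Collect closed)"
      "sets (distr N borel (\<lambda>S. S)) = sigma_sets UNIV (Collect closed)"
      unfolding sets_distr by (simp_all add: borel_eq_closed)
  qed auto
  \<comment> \<open>The retraction is the identity on configurations, so transporting to the Borel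
    sets and back recovers the measure.\<close>
  moreover have "distr (distr L borel (\<lambda>S. S)) config_space (\<lambda>\<omega> i. S2_retract (\<omega> i)) = L"
    if L: "sets L = sets config_space" "(\<lambda>S. S) \<in> borel_measurable L" for L
  proof -
    have "(\<lambda>\<omega> i. S2_retract (\<omega> i)) \<in> borel \<rightarrow>\<^sub>M config_space"
      using measurable_S2_retract_config by (simp add: measurable_cong_sets[OF sets_PiM_equal_borel refl])
    then have "distr (distr L borel (\<lambda>S. S)) config_space (\<lambda>\<omega> i. S2_retract (\<omega> i)) =
        distr L config_space (\<lambda>\<omega> i. S2_retract (\<omega> i))"
      using L(2) by (subst distr_distr) (auto simp: o_def)
    also have "\<dots> = distr L L (\<lambda>S. S)"
      using sets_eq_imp_space_eq[OF L(1)]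
      by (intro distr_cong) (auto simp: L(1) space_config_space PiE_iff fun_eq_iff)
    finally show ?thesis
      by (simp add: distr_id)
  qed
  ultimately show ?thesis
    using M(2) N(2) id by metis
qed

subsection \<open>The two-sided stationary chain\<close>

text \<open>The stationary chain on a block: the leftmost spin is uniform and every further spin is
  drawn from the kernel. The right end is free, hence the density 1.\<close>

definition chain_measure :: "real \<Rightarrow> int \<Rightarrow> int \<Rightarrow> (int \<Rightarrow> real^3) measure"
  where "chain_measure \<beta> n m =
    density (block_measure {n..m}) (end_weight \<beta> (\<lambda>_. 1 / (4 * pi)) (\<lambda>_. 1) n m)"

lemma sets_chain_measure[measurable_cong]: "sets (chain_measure \<beta> n m) = sets (block_measure {n..m})"
  by (simp add: chain_measure_def)

lemma space_chain_measure: "space (chain_measure \<beta> n m) = {n..m} \<rightarrow>\<^sub>E S2"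
  by (simp add: chain_measure_def space_block_measure)

lemma measurable_block_restrict_borel:
  "J \<subseteq> I \<Longrightarrow> (\<lambda>s. restrict s J) \<in> block_measure I \<rightarrow>\<^sub>M (\<Pi>\<^sub>M i\<in>J. borel)"
  by (intro measurable_restrict borel_measurable_block_component) auto

text \<open>Half-width of a symmetric block containing \<open>J\<close>; inserting 0 gives
  \<open>Max\<close> a value for empty \<open>J\<close>.\<close>

definition radius :: "int set \<Rightarrow> int"
  where "radius J = Max (insert 0 (abs ` J))"

lemma radius_nonneg: "finite J \<Longrightarrow> 0 \<le> radius J"
  unfolding radius_def by (rule Max_ge) auto

lemma subset_radius:
  assumes "finite J"
  shows "J \<subseteq> {- radius J..radius J}"
proof
  fix i assume "i \<in> J"
  then have "\<bar>i\<bar> \<le> radius J"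
    using assms unfolding radius_def by (intro Max_ge) auto
  then show "i \<in> {- radius J..radius J}"
    by auto
qed

lemma radius_mono: "J \<subseteq> H \<Longrightarrow> finite H \<Longrightarrow> radius J \<le> radius H"
  unfolding radius_def by (intro Max_mono) auto

text \<open>Finite index sets may have gaps, so the marginal is cut out of a surrounding block.
  Spins are regarded as points of \<open>real^3\<close>, since the extension theorem speaks of the
  Borel sets of a Polish type.\<close>

definition chain_marginal :: "real \<Rightarrow> int set \<Rightarrow> (int \<Rightarrow> real^3) measure"
  where "chain_marginal \<beta> J =
    distr (chain_measure \<beta> (- radius J) (radius J)) (\<Pi>\<^sub>M i\<in>J. borel) (\<lambda>s. restrict s J)"

context
  fixes \<beta> :: real
  assumes \<beta>: "0 < \<beta>"
begin

text \<open>Constants are fixed by \<open>transfer\<close> on the sphere, so cutting off spins at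
  either end leaves the end densities unchanged.\<close>

lemma distr_chain_measure:
  assumes "n' \<le> n" "n \<le> m" "m \<le> m'"
  shows "distr (chain_measure \<beta> n' m') (block_measure {n..m}) (\<lambda>s. restrict s {n..m}) = chain_measure \<beta> n m"
proof -
  define k where "k = nat (n - n')"
  define l where "l = nat (m' - m)"
  have n': "n' = n - int k" and m': "m' = m + int l"
    using assms by (auto simp: k_def l_def)
  have c: "bounded_density (\<lambda>_. 1 / (4 * pi))" "bounded_density (\<lambda>_. 1)"
    by (intro bounded_density_const; simp)+
  have "distr (chain_measure \<beta> n' m') (block_measure {n..m}) (\<lambda>s. restrict s {n..m}) =
      density (block_measure {n..m}) (end_weight \<beta> ((transfer \<beta> ^^ k) (\<lambda>_. 1 / (4 * pi))) ((transfer \<beta> ^^ l) (\<lambda>_. 1)) n m)"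
    unfolding chain_measure_def n' m' by (rule distr_end_weight[OF \<beta> assms(2) c])
  also have "\<dots> = chain_measure \<beta> n m"
    unfolding chain_measure_def
  proof (rule density_cong)
    show "AE s in block_measure {n..m}. ennreal (end_weight \<beta> ((transfer \<beta> ^^ k) (\<lambda>_. 1 / (4 * pi))) ((transfer \<beta> ^^ l) (\<lambda>_. 1)) n m s) =
        ennreal (end_weight \<beta> (\<lambda>_. 1 / (4 * pi)) (\<lambda>_. 1) n m s)"
    proof (rule AE_I2)
      fix s assume "s \<in> space (block_measure {n..m})"
      then have "s n \<in> S2" "s m \<in> S2"
        using assms by (auto simp: space_PiM)
      then show "ennreal (end_weight \<beta> ((transfer \<beta> ^^ k) (\<lambda>_. 1 / (4 * pi))) ((transfer \<beta> ^^ l) (\<lambda>_. 1)) n m s) =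
          ennreal (end_weight \<beta> (\<lambda>_. 1 / (4 * pi)) (\<lambda>_. 1) n m s)"
        by (simp only: end_weight_def funpow_transfer_const[OF \<beta>])
    qed
  qed (use c assms in \<open>auto intro!: measurable_compose[OF _ measurable_ennreal] borel_measurable_end_weight bounded_density_funpow_transfer \<beta>\<close>)
  finally show ?thesis .
qed

lemma prob_space_chain_measure:
  assumes nm: "n \<le> m"
  shows "prob_space (chain_measure \<beta> n m)"
proof
  let ?e = "end_weight \<beta> (\<lambda>_. 1 / (4 * pi)) (\<lambda>_. 1) n m"
  have c: "bounded_density (\<lambda>_. 1 / (4 * pi))" "bounded_density (\<lambda>_. 1)"
    by (intro bounded_density_const; simp)+
  have [measurable]: "?e \<in> borel_measurable (block_measure {n..m})"
    by (intro borel_measurable_end_weight c nm) simp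
  have int: "integrable (block_measure {n..m}) ?e"
    using integrable_times_end_weight[OF \<beta> nm c, of "\<lambda>_. 1" 1] by simp
  have "emeasure (chain_measure \<beta> n m) (space (chain_measure \<beta> n m)) = (\<integral>\<^sup>+s. ennreal (?e s) \<partial>block_measure {n..m})"
    unfolding chain_measure_def
    by (subst emeasure_density) (auto intro!: nn_integral_cong)
  also have "\<dots> = ennreal (LINT s|block_measure {n..m}. ?e s)"
    using int end_weight_nonneg[OF \<beta> c] by (intro nn_integral_eq_integral) auto
  also have "(LINT s|block_measure {n..m}. ?e s) = 1"
    using integral_chain_weight[OF \<beta> nm] by (simp add: end_weight_def)
  finally show "emeasure (chain_measure \<beta> n m) (space (chain_measure \<beta> n m)) = 1"
    by simp
qed

text \<open>Any larger symmetric block yields the same marginal, so the marginals of two nested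
  index sets can be compared on a single block.\<close>

lemma chain_marginal_eq:
  assumes J: "finite J" "J \<subseteq> {- r..r}" and r: "radius J \<le> r"
  shows "chain_marginal \<beta> J = distr (chain_measure \<beta> (- r) r) (\<Pi>\<^sub>M i\<in>J. borel) (\<lambda>s. restrict s J)"
proof -
  let ?R = "radius J"
  have sub: "J \<subseteq> {- ?R..?R}" "{- ?R..?R} \<subseteq> {- r..r}"
    using subset_radius[OF J(1)] r by auto
  have m1: "(\<lambda>s. restrict s {- ?R..?R}) \<in> chain_measure \<beta> (- r) r \<rightarrow>\<^sub>M block_measure {- ?R..?R}"
    unfolding measurable_cong_sets[OF sets_chain_measure refl]
    by (rule measurable_restrict_block[OF sub(2)])
  have m2: "(\<lambda>s. restrict s J) \<in> block_measure {- ?R..?R} \<rightarrow>\<^sub>M (\<Pi>\<^sub>M i\<in>J. borel)"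
    by (rule measurable_block_restrict_borel[OF sub(1)])
  have "chain_marginal \<beta> J = distr (distr (chain_measure \<beta> (- r) r) (block_measure {- ?R..?R}) (\<lambda>s. restrict s {- ?R..?R}))
      (\<Pi>\<^sub>M i\<in>J. borel) (\<lambda>s. restrict s J)"
    unfolding chain_marginal_def using r radius_nonneg[OF J(1)] by (subst distr_chain_measure) auto
  also have "\<dots> = distr (chain_measure \<beta> (- r) r) (\<Pi>\<^sub>M i\<in>J. borel) (\<lambda>s. restrict (restrict s {- ?R..?R}) J)"
    by (subst distr_distr[OF m2 m1]) (simp only: o_def)
  finally show ?thesis
    using sub(1) by (simp only: restrict_restrict Int_absorb1)
qed

lemma polish_projective_chain_marginal: "polish_projective UNIV (chain_marginal \<beta>)"
  unfolding polish_projective_def projective_family_def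
proof (intro conjI allI impI)
  fix J H :: "int set"
  assume sub: "J \<subseteq> H" and H: "finite H"
  have J: "finite J"
    using sub H by (rule finite_subset)
  let ?r = "radius H"
  have m1: "(\<lambda>s. restrict s H) \<in> chain_measure \<beta> (- ?r) ?r \<rightarrow>\<^sub>M (\<Pi>\<^sub>M i\<in>H. borel)"
    unfolding measurable_cong_sets[OF sets_chain_measure refl]
    by (rule measurable_block_restrict_borel[OF subset_radius[OF H]])
  have m2: "(\<lambda>s. restrict s J) \<in> (\<Pi>\<^sub>M i\<in>H. (borel :: (real^3) measure)) \<rightarrow>\<^sub>M (\<Pi>\<^sub>M i\<in>J. borel)"
    by (rule measurable_restrict_subset[OF sub])
  have "distr (chain_marginal \<beta> H) (\<Pi>\<^sub>M i\<in>J. borel) (\<lambda>s. restrict s J) =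
      distr (chain_measure \<beta> (- ?r) ?r) (\<Pi>\<^sub>M i\<in>J. borel) (\<lambda>s. restrict (restrict s H) J)"
    unfolding chain_marginal_def by (subst distr_distr[OF m2 m1]) (simp only: o_def)
  also have "\<dots> = distr (chain_measure \<beta> (- ?r) ?r) (\<Pi>\<^sub>M i\<in>J. borel) (\<lambda>s. restrict s J)"
    using sub by (simp only: restrict_restrict Int_absorb1)
  also have "\<dots> = chain_marginal \<beta> J"
    using J sub subset_radius[OF H] radius_mono[OF sub H] by (intro chain_marginal_eq[symmetric]) auto
  finally show "chain_marginal \<beta> J = distr (chain_marginal \<beta> H) (\<Pi>\<^sub>M i\<in>J. borel) (\<lambda>s. restrict s J)"
    by simp
next
  fix J :: "int set"
  assume J: "finite J"
  show "prob_space (chain_marginal \<beta> J)"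
    unfolding chain_marginal_def
  proof (rule prob_space.prob_space_distr)
    show "prob_space (chain_measure \<beta> (- radius J) (radius J))"
      using radius_nonneg[OF J] by (intro prob_space_chain_measure) auto
    show "(\<lambda>s. restrict s J) \<in> chain_measure \<beta> (- radius J) (radius J) \<rightarrow>\<^sub>M (\<Pi>\<^sub>M i\<in>J. borel)"
      unfolding measurable_cong_sets[OF sets_chain_measure refl]
      by (rule measurable_block_restrict_borel[OF subset_radius[OF J]])
  qed
qed

text \<open>The Kolmogorov limit is a measure on sequences in \<open>real^3\<close>. Applying
  \<open>S2_retract\<close> lands in \<open>config_space\<close> and leaves the finite marginals
  alone, as these come from tuples on the sphere.\<close>

lemma ex_infinite_chain:
  obtains M where "prob_space M" "sets M = sets config_space"
    "\<And>n m. n \<le> m \<Longrightarrow> distr M (block_measure {n..m}) (\<lambda>S. restrict S {n..m}) = chain_measure \<beta> n m"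
proof -
  interpret P: polish_projective UNIV "chain_marginal \<beta>"
    by (rule polish_projective_chain_marginal)
  define M where "M = distr P.lim config_space (\<lambda>\<omega> i. S2_retract (\<omega> i))"
  have retr: "(\<lambda>\<omega> i. S2_retract (\<omega> i)) \<in> P.lim \<rightarrow>\<^sub>M config_space"
    using measurable_S2_retract_config by (simp add: measurable_cong_sets[OF P.sets_lim refl])
  have lim: "distr P.lim (\<Pi>\<^sub>M i\<in>J. borel) (\<lambda>\<omega>. restrict \<omega> J) = chain_marginal \<beta> J" if J: "finite J" for J
  proof (rule measure_eqI)
    fix X assume "X \<in> sets (distr P.lim (\<Pi>\<^sub>M i\<in>J. borel) (\<lambda>\<omega>. restrict \<omega> J))"
    then have X: "X \<in> sets (\<Pi>\<^sub>M i\<in>J. (borel :: (real^3) measure))"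
      by simp
    have m: "(\<lambda>\<omega>. restrict \<omega> J) \<in> P.lim \<rightarrow>\<^sub>M (\<Pi>\<^sub>M i\<in>J. borel)"
      unfolding measurable_cong_sets[OF P.sets_lim refl] by (rule measurable_restrict_subset) simp
    show "emeasure (distr P.lim (\<Pi>\<^sub>M i\<in>J. borel) (\<lambda>\<omega>. restrict \<omega> J)) X = emeasure (chain_marginal \<beta> J) X"
      using P.emeasure_lim_emb[of J X] J X by (simp add: emeasure_distr[OF m X] prod_emb_def space_PiM)
  qed (simp add: chain_marginal_def)
  have "distr M (block_measure {n..m}) (\<lambda>S. restrict S {n..m}) = chain_measure \<beta> n m" if nm: "n \<le> m" for n m
  proof -
    define J where "J = {n..m}"
    \<comment> \<open>Retracting and then restricting to \<open>J\<close> equals restricting and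
      then applying \<open>\<rho>\<close>; the latter involves finitely many sites and can be
      evaluated on \<open>chain_marginal \<beta> J\<close>.\<close>
    define \<rho> where "\<rho> s = (\<lambda>i\<in>J. S2_retract (s i))" for s
    let ?r = "radius J"
    have J: "finite J" "J \<subseteq> {- ?r..?r}"
      using subset_radius[of J] by (simp_all add: J_def)
    have \<rho>: "\<rho> \<in> (\<Pi>\<^sub>M i\<in>J. borel) \<rightarrow>\<^sub>M block_measure J"
      unfolding \<rho>_def measurable_cong_sets[OF refl sets_block_measure]
      by (intro measurable_restrict measurable_compose[OF _ measurable_S2_retract] measurable_component_singleton)
    have m: "(\<lambda>\<omega>. restrict \<omega> J) \<in> P.lim \<rightarrow>\<^sub>M (\<Pi>\<^sub>M i\<in>J. borel)"
      unfolding measurable_cong_sets[OF P.sets_lim refl] by (rule measurable_restrict_subset) simp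
    have mc: "(\<lambda>s. restrict s J) \<in> chain_measure \<beta> (- ?r) ?r \<rightarrow>\<^sub>M (\<Pi>\<^sub>M i\<in>J. borel)"
      unfolding measurable_cong_sets[OF sets_chain_measure refl]
      by (rule measurable_block_restrict_borel[OF J(2)])
    have "distr M (block_measure J) (\<lambda>S. restrict S J) =
        distr P.lim (block_measure J) (\<lambda>\<omega>. restrict (\<lambda>i. S2_retract (\<omega> i)) J)"
      unfolding M_def by (subst distr_distr[OF measurable_config_restrict retr]) (simp only: o_def)
    also have "\<dots> = distr P.lim (block_measure J) (\<rho> \<circ> (\<lambda>\<omega>. restrict \<omega> J))"
      by (rule arg_cong[where f = "distr _ _"]) (auto simp: \<rho>_def fun_eq_iff)
    also have "\<dots> = distr (chain_marginal \<beta> J) (block_measure J) \<rho>"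
      by (simp add: distr_distr[OF \<rho> m, symmetric] lim J)
    also have "\<dots> = distr (chain_measure \<beta> (- ?r) ?r) (block_measure J) (\<rho> \<circ> (\<lambda>s. restrict s J))"
      unfolding chain_marginal_def by (rule distr_distr[OF \<rho> mc])
    also have "\<dots> = distr (chain_measure \<beta> (- ?r) ?r) (block_measure J) (\<lambda>s. restrict s J)"
    proof (intro distr_cong refl)
      fix s assume "s \<in> space (chain_measure \<beta> (- ?r) ?r)"
      then have "s i \<in> S2" if "i \<in> J" for i
        using that J(2) by (auto simp: space_chain_measure)
      then show "(\<rho> \<circ> (\<lambda>s. restrict s J)) s = restrict s J"
        by (auto simp: \<rho>_def fun_eq_iff)
    qed
    also have "\<dots> = chain_measure \<beta> n m"
      using J(2) nm unfolding J_def by (intro distr_chain_measure) auto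
    finally show ?thesis
      by (simp only: J_def)
  qed
  moreover have "prob_space M" "sets M = sets config_space"
    unfolding M_def by (auto intro: P.P.prob_space_distr retr)
  ultimately show thesis
    using that by blast
qed

end

subsection \<open>The DLR condition for the stationary chain\<close>

text \<open>The two bonds joining a block to its neighbours complete the chain weight of the
  enlarged block, so the stationary density there is the DLR weight up to the factor
  \<open>1 / (4 * pi)\<close>.\<close>

lemma boundary_weight_merge:
  assumes "a \<le> b"
  shows "chain_weight \<beta> (a - 1) (b + 1) (merge {a - 1, b + 1} {a..b} (x, y)) =
    boundary_weight \<beta> a b (x (a - 1)) (x (b + 1)) y"
proof -
  let ?s = "merge {a - 1, b + 1} {a..b} (x, y)"
  have "chain_weight \<beta> (a - 1) (b + 1) ?s =
      spin_kernel \<beta> (?s (a - 1)) (?s a) * chain_weight \<beta> a b ?s * spin_kernel \<beta> (?s b) (?s (b + 1))"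
    using assms by (simp add: chain_weight_extend_right chain_weight_extend_left)
  moreover have "chain_weight \<beta> a b ?s = chain_weight \<beta> a b y"
    by (rule chain_weight_cong) (auto simp: merge_def)
  ultimately show ?thesis
    using assms by (simp add: boundary_weight_def merge_def)
qed

lemma borel_measurable_boundary_weight:
  assumes "a \<le> b"
  shows "(\<lambda>(uv, y). boundary_weight \<beta> a b (fst uv) (snd uv) y) \<in>
    borel_measurable ((S2_borel \<Otimes>\<^sub>M S2_borel) \<Otimes>\<^sub>M block_measure {a..b})"
proof -
  have [measurable]: "chain_weight \<beta> a b \<in> borel_measurable (block_measure {a..b})"
    "(\<lambda>y. y a) \<in> borel_measurable (block_measure {a..b})"
    "(\<lambda>y. y b) \<in> borel_measurable (block_measure {a..b})"
    using assms by (auto intro!: borel_measurable_chain_weight borel_measurable_block_component)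
  have [measurable]: "fst \<in> S2_borel \<Otimes>\<^sub>M S2_borel \<rightarrow>\<^sub>M borel" "snd \<in> S2_borel \<Otimes>\<^sub>M S2_borel \<rightarrow>\<^sub>M borel"
    by (rule measurable_compose[OF _ measurable_ident_S2(1)], simp)+
  show ?thesis
    unfolding boundary_weight_def split_beta by measurable
qed

context
  fixes \<beta> :: real and M :: "(int \<Rightarrow> real^3) measure"
  assumes \<beta>: "0 < \<beta>"
    and M: "prob_space M" "sets M = sets config_space"
    and M_chain: "\<And>n m. n \<le> m \<Longrightarrow> distr M (block_measure {n..m}) (\<lambda>S. restrict S {n..m}) = chain_measure \<beta> n m"
begin

lemma integral_chain:
  assumes nm: "n \<le> m" and f[measurable]: "f \<in> borel_measurable (block_measure {n..m})"
  shows "(LINT S|M. f (restrict S {n..m})) =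
    1 / (4 * pi) * (LINT s|block_measure {n..m}. f s * chain_weight \<beta> n m s)"
proof -
  have c: "bounded_density (\<lambda>_. 1 / (4 * pi))" "bounded_density (\<lambda>_. 1)"
    by (intro bounded_density_const; simp)+
  have [measurable]: "end_weight \<beta> (\<lambda>_. 1 / (4 * pi)) (\<lambda>_. 1) n m \<in> borel_measurable (block_measure {n..m})"
    by (intro borel_measurable_end_weight c nm) simp
  have m: "(\<lambda>S. restrict S {n..m}) \<in> M \<rightarrow>\<^sub>M block_measure {n..m}"
    unfolding measurable_cong_sets[OF M(2) refl] by (rule measurable_config_restrict)
  have "(LINT S|M. f (restrict S {n..m})) = (LINT s|chain_measure \<beta> n m. f s)"
    unfolding M_chain[OF nm, symmetric] by (rule integral_distr[symmetric, OF m f])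
  also have "\<dots> = (LINT s|block_measure {n..m}. end_weight \<beta> (\<lambda>_. 1 / (4 * pi)) (\<lambda>_. 1) n m s * f s)"
    unfolding chain_measure_def using end_weight_nonneg[OF \<beta> c]
    by (subst integral_real_density) auto
  also have "\<dots> = (LINT s|block_measure {n..m}. 1 / (4 * pi) * (f s * chain_weight \<beta> n m s))"
    by (simp add: end_weight_def mult_ac)
  finally show ?thesis
    by (simp only: integral_mult_right_zero)
qed

text \<open>Fubini on the enlarged block separates the two neighbouring spins from the interior, and
  the factor \<open>\<phi>\<close> comes out of the inner integral.\<close>

lemma integral_chain_boundary:
  assumes ab: "a \<le> b"
    and \<phi>[measurable]: "\<phi> \<in> borel_measurable (S2_borel \<Otimes>\<^sub>M S2_borel)"
    and \<phi>_bound: "\<And>u v. u \<in> S2 \<Longrightarrow> v \<in> S2 \<Longrightarrow> \<bar>\<phi> (u, v)\<bar> \<le> B"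
    and f[measurable]: "f \<in> borel_measurable (block_measure {a..b})"
    and f_bound: "\<And>s. s \<in> {a..b} \<rightarrow>\<^sub>E S2 \<Longrightarrow> \<bar>f s\<bar> \<le> C"
  shows "(LINT S|M. \<phi> (S (a - 1), S (b + 1)) * f (restrict S {a..b})) =
    1 / (4 * pi) * (LINT x|block_measure {a - 1, b + 1}. \<phi> (x (a - 1), x (b + 1)) *
      (LINT y|block_measure {a..b}. f y * boundary_weight \<beta> a b (x (a - 1)) (x (b + 1)) y))"
proof -
  let ?I = "{a - 1, b + 1}" and ?J = "{a..b}" and ?K = "{a - 1..b + 1}"
  define F where "F s = \<phi> (s (a - 1), s (b + 1)) * f (restrict s ?J)" for s
  have K: "?K = ?I \<union> ?J"
    using ab by auto
  have comp: "(\<lambda>s. s i) \<in> block_measure ?K \<rightarrow>\<^sub>M S2_borel" if "i \<in> ?K" for i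
    using measurable_component_singleton[OF that, of "\<lambda>_. S2_area"] measurable_cong_sets[OF refl sets_S2_area]
    by blast
  have [measurable]: "(\<lambda>s. s (a - 1)) \<in> block_measure ?K \<rightarrow>\<^sub>M S2_borel"
    "(\<lambda>s. s (b + 1)) \<in> block_measure ?K \<rightarrow>\<^sub>M S2_borel"
    using ab by (auto intro!: comp)
  have [measurable]: "(\<lambda>s. restrict s ?J) \<in> block_measure ?K \<rightarrow>\<^sub>M block_measure ?J"
    by (rule measurable_restrict_block) auto
  have F[measurable]: "F \<in> borel_measurable (block_measure ?K)"
    unfolding F_def by measurable
  have [measurable]: "chain_weight \<beta> (a - 1) (b + 1) \<in> borel_measurable (block_measure ?K)"
    by (rule borel_measurable_chain_weight) simp
  obtain D where D: "0 \<le> D" "\<And>s. s \<in> ?K \<rightarrow> S2 \<Longrightarrow> chain_weight \<beta> (a - 1) (b + 1) s \<le> D"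
    using chain_weight_bound[OF \<beta>] by blast
  interpret K: finite_measure "block_measure ?K"
    by (rule finite_block_measure) simp
  have int: "integrable (block_measure ?K) (\<lambda>s. F s * chain_weight \<beta> (a - 1) (b + 1) s)"
  proof (rule K.integrable_const_bound[where B = "B * C * D"])
    show "AE s in block_measure ?K. norm (F s * chain_weight \<beta> (a - 1) (b + 1) s) \<le> B * C * D"
    proof (rule AE_I2)
      fix s assume "s \<in> space (block_measure ?K)"
      then have s: "s \<in> ?K \<rightarrow> S2" "s (a - 1) \<in> S2" "s (b + 1) \<in> S2" "restrict s ?J \<in> ?J \<rightarrow>\<^sub>E S2"
        using ab by (auto simp: space_PiM PiE_iff)
      show "norm (F s * chain_weight \<beta> (a - 1) (b + 1) s) \<le> B * C * D"
        using \<phi>_bound[OF s(2,3)] f_bound[OF s(4)] D(1) D(2)[OF s(1)] chain_weight_nonneg[OF \<beta>, of "a - 1" "b + 1" s]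
        unfolding F_def real_norm_def abs_mult by (intro mult_mono) auto
    qed
  qed measurable
  have "(LINT S|M. \<phi> (S (a - 1), S (b + 1)) * f (restrict S ?J)) = (LINT S|M. F (restrict S ?K))"
  proof -
    have "?K \<inter> ?J = ?J" "a - 1 \<in> ?K" "b + 1 \<in> ?K"
      using ab by auto
    then show ?thesis
      unfolding F_def restrict_restrict by (simp only: restrict_apply')
  qed
  also have "\<dots> = 1 / (4 * pi) * (LINT s|block_measure ?K. F s * chain_weight \<beta> (a - 1) (b + 1) s)"
    using ab by (intro integral_chain F) simp
  also have "(LINT s|block_measure ?K. F s * chain_weight \<beta> (a - 1) (b + 1) s) =
      (LINT x|block_measure ?I. LINT y|block_measure ?J.
        F (merge ?I ?J (x, y)) * chain_weight \<beta> (a - 1) (b + 1) (merge ?I ?J (x, y)))"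
    unfolding K by (rule S2_prod.product_integral_fold[OF _ _ _ int[unfolded K]]) auto
  also have "\<dots> = (LINT x|block_measure ?I. \<phi> (x (a - 1), x (b + 1)) *
      (LINT y|block_measure ?J. f y * boundary_weight \<beta> a b (x (a - 1)) (x (b + 1)) y))"
  proof (rule Bochner_Integration.integral_cong[OF refl])
    fix x
    have "(LINT y|block_measure ?J. F (merge ?I ?J (x, y)) * chain_weight \<beta> (a - 1) (b + 1) (merge ?I ?J (x, y))) =
        (LINT y|block_measure ?J. \<phi> (x (a - 1), x (b + 1)) * (f y * boundary_weight \<beta> a b (x (a - 1)) (x (b + 1)) y))"
    proof (rule Bochner_Integration.integral_cong[OF refl])
      fix y assume "y \<in> space (block_measure ?J)"
      then have "restrict (merge ?I ?J (x, y)) ?J = y"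
        using ab by (auto simp: space_PiM PiE_iff merge_def extensional_def fun_eq_iff)
      then show "F (merge ?I ?J (x, y)) * chain_weight \<beta> (a - 1) (b + 1) (merge ?I ?J (x, y)) =
          \<phi> (x (a - 1), x (b + 1)) * (f y * boundary_weight \<beta> a b (x (a - 1)) (x (b + 1)) y)"
        unfolding F_def boundary_weight_merge[OF ab] by (simp add: merge_def mult.assoc)
    qed
    then show "(LINT y|block_measure ?J. F (merge ?I ?J (x, y)) * chain_weight \<beta> (a - 1) (b + 1) (merge ?I ?J (x, y))) =
        \<phi> (x (a - 1), x (b + 1)) * (LINT y|block_measure ?J. f y * boundary_weight \<beta> a b (x (a - 1)) (x (b + 1)) y)"
      by (simp only: integral_mult_right_zero)
  qed
  finally show ?thesis .
qed

text \<open>A conditional expectation is characterised by its integrals over boundary events.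
  Integrating out the interior turns \<open>f\<close> into \<open>H\<close> and 1 into
  \<open>Z\<close>; since \<open>g * Z = H\<close>, the observable and the candidate
  \<open>g\<close> have the same integrals.\<close>

lemma DLR_chain: "DLR \<beta> M"
  unfolding DLR_def
proof (intro allI impI)
  fix a b :: int and f
  assume ab: "a \<le> b" and f: "bounded_continuous a b f"
  interpret prob_space M by fact
  have space_M: "space M = UNIV \<rightarrow>\<^sub>E S2"
    using sets_eq_imp_space_eq[OF M(2)] by (simp add: space_config_space)
  let ?J = "{a..b}" and ?F = "boundary_algebra a b"
  let ?pair = "\<lambda>S :: int \<Rightarrow> real^3. (S (a - 1), S (b + 1))"
  have fm[measurable]: "f \<in> borel_measurable (block_measure ?J)"
    by (rule borel_measurable_bounded_continuous[OF f])
  obtain B where B: "0 \<le> B" "\<And>s. s \<in> ?J \<rightarrow>\<^sub>E S2 \<Longrightarrow> \<bar>f s\<bar> \<le> B"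
    using bounded_continuous_bound[OF f] by blast
  interpret J: finite_measure "block_measure ?J"
    by (rule finite_block_measure) simp
  define H where "H uv = (LINT y|block_measure ?J. f y * boundary_weight \<beta> a b (fst uv) (snd uv) y)" for uv
  define Z where "Z uv = (LINT y|block_measure ?J. boundary_weight \<beta> a b (fst uv) (snd uv) y)" for uv
  define g where "g uv = 1 / Z uv * H uv" for uv
  note borel_measurable_boundary_weight[OF ab, measurable]
  have [measurable]: "H \<in> borel_measurable (S2_borel \<Otimes>\<^sub>M S2_borel)" "Z \<in> borel_measurable (S2_borel \<Otimes>\<^sub>M S2_borel)"
    unfolding H_def Z_def by (rule J.borel_measurable_lebesgue_integral; measurable)+
  have g[measurable]: "g \<in> borel_measurable (S2_borel \<Otimes>\<^sub>M S2_borel)"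
    unfolding g_def by measurable
  have Z_nonneg: "0 \<le> Z (u, v)" and H_le: "\<bar>H (u, v)\<bar> \<le> B * Z (u, v)" if "u \<in> S2" "v \<in> S2" for u v
  proof -
    note bd = that[THEN bounded_density_spin_kernel[OF \<beta>]]
    show "\<bar>H (u, v)\<bar> \<le> B * Z (u, v)"
      using abs_integral_end_weight_le[OF \<beta> ab bd fm B(2)] by (simp add: H_def Z_def boundary_weight_eq)
    show "0 \<le> Z (u, v)"
      using end_weight_nonneg[OF \<beta> bd] by (simp add: Z_def boundary_weight_eq)
  qed
  \<comment> \<open>Where \<open>Z\<close> vanishes, \<open>H_le\<close> forces \<open>H\<close> to
    vanish too, so the product formula and the bound survive the convention
    \<open>1 / 0 = 0\<close>.\<close>
  have gZ: "g (u, v) * Z (u, v) = H (u, v)" and g_le: "\<bar>g (u, v)\<bar> \<le> B" if "u \<in> S2" "v \<in> S2" for u v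
    using H_le[OF that] Z_nonneg[OF that] B(1)
    by (cases "Z (u, v) = 0"; auto simp: g_def divide_le_eq)+
  have pair: "?pair \<in> ?F \<rightarrow>\<^sub>M S2_borel \<Otimes>\<^sub>M S2_borel"
    unfolding boundary_algebra_def
    by (rule measurable_vimage_algebra1) (auto simp: space_config_space space_pair_measure space_restrict_space)
  have gF: "(\<lambda>S. g (?pair S)) \<in> borel_measurable ?F"
    by (rule measurable_compose[OF pair g])
  have sub: "subalgebra M ?F"
    by (rule subalgebra_boundary_algebra[OF M(2)])
  interpret sigma_finite_subalgebra M ?F
    by (intro finite_measure_subalgebra_is_sigma_finite finite_measure_subalgebra.intro
        finite_measure_axioms finite_measure_subalgebra_axioms.intro sub)
  have m: "(\<lambda>S. restrict S ?J) \<in> M \<rightarrow>\<^sub>M block_measure ?J"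
    unfolding measurable_cong_sets[OF M(2) refl] by (rule measurable_config_restrict)
  have "AE S in M. real_cond_exp M ?F (\<lambda>S. f (restrict S ?J)) S = g (?pair S)"
  proof (rule real_cond_exp_charact)
    have "\<bar>f (restrict S ?J)\<bar> \<le> B" if "S \<in> space M" for S
      by (rule B(2)) (use that in \<open>auto simp: space_M\<close>)
    then show "integrable M (\<lambda>S. f (restrict S ?J))"
      unfolding real_norm_def[symmetric]
      by (intro integrable_const_bound[where B = B] measurable_compose[OF m fm] AE_I2)
    show "integrable M (\<lambda>S. g (?pair S))"
      by (rule integrable_const_bound[where B = B])
         (auto simp: space_M PiE_iff intro!: g_le measurable_from_subalg[OF sub gF])
    fix A assume "A \<in> sets ?F"
    \<comment> \<open>Events of the boundary algebra are preimages of events for the neighbouring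
      pair, so their indicators are functions of the two boundary spins.\<close>
    then obtain A' where A': "A' \<in> sets (S2_borel \<Otimes>\<^sub>M S2_borel)" "A = ?pair -` A' \<inter> space config_space"
      unfolding boundary_algebra_def
      by (subst (asm) sets_vimage_algebra2) (auto simp: space_config_space space_pair_measure space_restrict_space)
    note A'(1)[measurable]
    have ind: "indicator A S = (indicator A' (?pair S) :: real)" if "S \<in> space M" for S
      using that by (auto simp: A'(2) indicator_def space_M space_config_space)
    have "(LINT S:A|M. f (restrict S ?J)) = (LINT S|M. indicator A' (?pair S) * f (restrict S ?J))"
      unfolding set_lebesgue_integral_def using ind by (intro Bochner_Integration.integral_cong) auto
    also have "\<dots> = 1 / (4 * pi) * (LINT x|block_measure {a - 1, b + 1}. indicator A' (?pair x) * H (?pair x))"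
      unfolding H_def fst_conv snd_conv
      by (rule integral_chain_boundary[OF ab _ _ fm B(2), where B = 1]) (auto simp: indicator_def)
    also have "\<dots> = 1 / (4 * pi) * (LINT x|block_measure {a - 1, b + 1}. indicator A' (?pair x) * g (?pair x) * Z (?pair x))"
    proof -
      have "indicator A' (?pair x) * H (?pair x) = indicator A' (?pair x) * g (?pair x) * Z (?pair x)"
        if "x \<in> space (block_measure {a - 1, b + 1})" for x
        using that by (subst gZ[symmetric]) (auto simp: space_PiM PiE_iff)
      then show ?thesis
        by (intro arg_cong[where f = "(*) (1 / (4 * pi))"] Bochner_Integration.integral_cong refl)
    qed
    \<comment> \<open>\<open>Z\<close> is written as the interior integral of the observable 1, so
      that \<open>integral_chain_boundary\<close> can be read backwards.\<close>
    also have "\<dots> = 1 / (4 * pi) * (LINT x|block_measure {a - 1, b + 1}. (\<lambda>p. indicator A' p * g p) (?pair x) *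
        (LINT y|block_measure ?J. 1 * boundary_weight \<beta> a b (x (a - 1)) (x (b + 1)) y))"
      by (simp add: Z_def)
    also have "\<dots> = (LINT S|M. (\<lambda>p. indicator A' p * g p) (?pair S) * 1)"
      using g_le B(1)
      by (intro integral_chain_boundary[OF ab, where B = B and C = 1, symmetric]) (auto simp: indicator_def)
    also have "\<dots> = (LINT S:A|M. g (?pair S))"
      unfolding set_lebesgue_integral_def using ind by (intro Bochner_Integration.integral_cong) auto
    finally show "(LINT S:A|M. f (restrict S ?J)) = (LINT S:A|M. g (?pair S))" .
  qed (rule gF)
  then show "AE S in M. real_cond_exp M ?F (\<lambda>S. f (restrict S ?J)) S =
      1 / partition_fun \<beta> a b (S (a - 1)) (S (b + 1)) *
        (LINT s|block_measure ?J. f s * boundary_weight \<beta> a b (S (a - 1)) (S (b + 1)) s)"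
    by (simp add: g_def H_def Z_def partition_fun_def)
qed

lemma gibbs_measure_chain: "gibbs_measure \<beta> M"
  using M DLR_chain by (simp add: gibbs_measure_def)

end

theorem proposition5p1:
  fixes \<beta> :: real
  assumes "\<beta> > 0"
  shows "(\<exists>!M. gibbs_measure \<beta> M) \<and>
    (\<forall>M. gibbs_measure \<beta> M \<longrightarrow>
      (\<forall>n m f. n \<le> m \<longrightarrow> bounded_continuous n m f \<longrightarrow>
        (LINT S|M. f (restrict S {n..m})) =
          1 / (4 * pi) * (LINT s|Pi\<^sub>M {n..m} (\<lambda>_. S2_area). f s * chain_weight \<beta> n m s)))"
proof (intro conjI allI impI ex_ex1I)
  show "\<exists>M. gibbs_measure \<beta> M"
    using ex_infinite_chain[OF assms] gibbs_measure_chain[OF assms] by metis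
next
  fix M N assume M: "gibbs_measure \<beta> M" and N: "gibbs_measure \<beta> N"
  show "M = N"
  proof (rule config_measure_eqI)
    show "prob_space M" "sets M = sets config_space" "prob_space N" "sets N = sets config_space"
      using M N by (auto simp: gibbs_measure_def)
    fix n m :: int and f
    assume "n \<le> m" "bounded_continuous n m f"
    then show "(LINT S|M. f (restrict S {n..m})) = (LINT S|N. f (restrict S {n..m}))"
      using gibbs_expectation[OF assms M] gibbs_expectation[OF assms N] by simp
  qed
qed (rule gibbs_expectation[OF assms])

end
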